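(* Let $X$ be an algebraic variety over $\mathbb F_q$ and let $C=(\mathcal C,|\cdot|,W)$ be coloring data with weights in $R=\mathbb Z[[t_1,\dots,t_N]][t_1^{-1},\dots,t_N^{-1}]$. Let the integers $v_{d,m}$ ($d\ge1$, $m\in\mathbb Z^N$) be defined by the formal identity $$Z_C(\bullet,t,T)=\prod_{m\in\mathbb Z^N,\ d\ge 1}(1-t^mT^d)^{-v_{d,m}},$$ and, for another formal variable $u$, let $$Z_C(u,t,T):=\prod_{m\in\mathbb Z^N,\ d\ge1}(1-u\,t^mT^d)^{-v_{d,m}}.$$ Suppose the zeta function of $X$ is written as a finite product $$Z(X,T)=\prod_i(1-x_iT)^{-n_i}$$ for some $x_i\in\mathbb C$ and $n_i\in\mathbb Z$. Then $$Z_C(X,t,T)=\prod_i Z_C(x_i,t,T)^{n_i},$$ where $Z_C(x_i,t,T)$ is obtained from $Z_C(u,t,T)$ by specializing $u=x_i$ (an identity of power series in $T$ with coefficients in $\mathbb C[[t_1,\dots,t_N]][t_1^{-1},\dots,t_N^{-1}]$).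
   Context: $\mathbb F_q$ is a finite field with $q$ elements, $\overline{\mathbb F}_q$ a fixed algebraic closure, and $\mathrm{Frob}_q: x\mapsto x^q$ the Frobenius automorphism, acting on $X(\overline{\mathbb F}_q)$. The zeta function of $X$ is $Z(X,T)=\exp\left(\sum_{r\ge1}N_r(X)\frac{T^r}{r}\right)$, where $N_r(X)=\#X(\mathbb F_{q^r})$. Coloring data $C=(\mathcal C,|\cdot|,W)$ consists of: a set $\mathcal C$ of colors; a degree function $|\cdot|:\mathcal C\to\mathbb Z_{\ge 0}$ such that there are finitely many colors of each degree and there is a unique color $0\in\mathcal C$ of degree $0$; and a weight function $W:\mathcal C\to R$ with $W(0)=1$, where $R=\mathbb Z[[t_1,\dots,t_N]][t_1^{-1},\dots,t_N^{-1}]$. For $f\in R$ and an integer $d\ge1$, $f(t^d)$ denotes the result of substituting $t_i\mapsto t_i^d$ for all $i$. For $m=(m_1,\dots,m_N)\in\mathbb Z^N$, $t^m=t_1^{m_1}\cdots t_N^{m_N}$. A coloring on $X$ is a map $\Lambda:X(\overline{\mathbb F}_q)\to\mathcal C$ with $\Lambda(x)=0$ for all but finitely many $x$; its degree is $|\Lambda|=\sum_{x\in X(\overline{\mathbb F}_q)}|\Lambda(x)|$. It is a coloring of $X/\mathbb F_q$ if $\Lambda(\mathrm{Frob}_q(x))=\Lambda(x)$ for all $x$. The weight of a coloring $\Lambda$ of $X/\mathbb F_q$ is $W(\Lambda)=\prod_{\{x\}}W(\Lambda(x))(t^{d(x)})$, the product running over the $\mathrm{Frob}_q$-orbits $\{x\}$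 in $X(\overline{\mathbb F}_q)$, with $d(x)$ the size of the orbit of $x$. The coloring zeta function of $X$ is $Z_C(X,t,T)=\sum_\Lambda W(\Lambda)T^{|\Lambda|}\in R[[T]]$, the sum running over all colorings $\Lambda$ of $X/\mathbb F_q$. For $X=\bullet$ a point this is $Z_C(\bullet,t,T)=\sum_{\lambda\in\mathcal C}W(\lambda)T^{|\lambda|}\in 1+T\,R[[T]]$. The $v_{d,m}$ are integers uniquely determined by $Z_C(\bullet,t,T)$, where it is understood that for each $d$ the series $\sum_m v_{d,m}t^m$ belongs to $R$. The coefficient of each power of $T$ in $Z_C(u,t,T)$ is a polynomial in $u$ with coefficients in $R$, so specializing $u$ to a complex number makes sense. *)

theory Defs
  imports
    "HOL-Library.Poly_Mapping"
    "HOL-Library.FuncSet"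
    "HOL-Library.Cardinality"
    "HOL-Computational_Algebra.Polynomial"
    "HOL-Computational_Algebra.Formal_Power_Series"
    "HOL-Algebra.Algebraic_Closure_Type"
    "HOL-Combinatorics.Orbits"
begin

section \<open>Laurent series in several variables\<close>

text \<open>
  An exponent vector is a finitely supported map \<open>nat \<Rightarrow>\<^sub>0 int\<close>; \<open>\<int>\<^sup>N\<close> is the set of those
  supported on the indices below \<open>N\<close>. Inverting the variables in the ring of power series in \<open>N\<close>
  variables gives the series whose exponents lie in \<open>\<int>\<^sup>N\<close> and are bounded below. The type \<open>mlaurent\<close>
  is the union over all \<open>N\<close> (including \<open>N = 0\<close>) of these rings; the ring for a given \<open>N\<close> is the
  subset \<open>laurent_ring N\<close>.
\<close>

definition int_vectors :: "nat \<Rightarrow> (nat \<Rightarrow>\<^sub>0 int) set" where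
  "int_vectors N = {m. Poly_Mapping.keys m \<subseteq> {..<N}}"

definition laurent_bound :: "nat \<Rightarrow> nat \<Rightarrow> ((nat \<Rightarrow>\<^sub>0 int) \<Rightarrow> 'a::zero) \<Rightarrow> bool" where
  "laurent_bound N K f \<longleftrightarrow>
     (\<forall>m. f m \<noteq> 0 \<longrightarrow> m \<in> int_vectors N \<and> (\<forall>i. - int K \<le> Poly_Mapping.lookup m i))"

lemma laurent_boundD:
  assumes "laurent_bound N K f" "f m \<noteq> 0"
  shows "m \<in> int_vectors N" "- int K \<le> Poly_Mapping.lookup m i"
  using assms by (auto simp: laurent_bound_def)

lemma laurent_bound_mono:
  assumes "laurent_bound N K f" "N \<le> N'" "K \<le> K'"
  shows "laurent_bound N' K' f"
  unfolding laurent_bound_def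
proof (intro allI impI conjI)
  fix m i assume "f m \<noteq> 0"
  note b = laurent_boundD[OF assms(1) this]
  show "m \<in> int_vectors N'" using b(1) assms(2) by (auto simp: int_vectors_def)
  show "- int K' \<le> Poly_Mapping.lookup m i" using b(2)[of i] assms(3) by linarith
qed

lemma int_vectors_add: "a \<in> int_vectors N \<Longrightarrow> b \<in> int_vectors N \<Longrightarrow> a + b \<in> int_vectors N"
  using Poly_Mapping.keys_add[of a b] by (auto simp: int_vectors_def)

typedef (overloaded) ('a::zero) mlaurent =
  "{f :: (nat \<Rightarrow>\<^sub>0 int) \<Rightarrow> 'a. \<exists>N K. laurent_bound N K f}"
  morphisms mlcoeff Abs_mlaurent
  by (rule exI[of _ "\<lambda>_. 0"]) (auto simp: laurent_bound_def)

setup_lifting type_definition_mlaurent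

lemma mlaurent_eqI: "(\<And>m. mlcoeff f m = mlcoeff g m) \<Longrightarrow> f = g"
  by (metis ext mlcoeff_inject)

lemma laurent_bound_common:
  assumes "\<exists>N K. laurent_bound N K f" "\<exists>N K. laurent_bound N K g"
  obtains N K where "laurent_bound N K f" "laurent_bound N K g"
proof -
  obtain N K N' K' where *: "laurent_bound N K f" "laurent_bound N' K' g"
    using assms by blast
  show ?thesis
    by (rule that[of "max N N'" "max K K'"]; rule laurent_bound_mono[OF *(1)] laurent_bound_mono[OF *(2)]) auto
qed

lemma finite_int_vectors_box:
  "finite {a \<in> int_vectors N. \<forall>i. lo i \<le> Poly_Mapping.lookup a i \<and> Poly_Mapping.lookup a i \<le> hi i}"
proof (rule inj_on_finite)
  let ?S = "{a \<in> int_vectors N. \<forall>i. lo i \<le> Poly_Mapping.lookup a i \<and> Poly_Mapping.lookup a i \<le> hi i}"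
  let ?g = "\<lambda>a. restrict (Poly_Mapping.lookup a) {..<N}"
  show "inj_on ?g ?S"
  proof (rule inj_onI, rule poly_mapping_eqI)
    fix a b i assume a: "a \<in> ?S" and b: "b \<in> ?S" and e: "?g a = ?g b"
    show "Poly_Mapping.lookup a i = Poly_Mapping.lookup b i"
    proof (cases "i < N")
      case True
      then show ?thesis using fun_cong[OF e, of i] by simp
    next
      case False
      then have "i \<notin> Poly_Mapping.keys a" "i \<notin> Poly_Mapping.keys b"
        using a b by (auto simp: int_vectors_def)
      then show ?thesis by (simp add: in_keys_iff)
    qed
  qed
  show "?g ` ?S \<subseteq> PiE {..<N} (\<lambda>i. {lo i..hi i})"
    by (intro image_subsetI restrict_PiE_iff[THEN iffD2]) auto
  show "finite (PiE {..<N} (\<lambda>i. {lo i..hi i}))" by (intro finite_PiE) auto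
qed

lemma finite_laurent_support:
  assumes "laurent_bound N K f" "laurent_bound N K g"
  shows "finite {a. f a \<noteq> 0 \<and> g (m - a) \<noteq> 0}"
proof (rule finite_subset[OF _ finite_int_vectors_box])
  show "{a. f a \<noteq> 0 \<and> g (m - a) \<noteq> 0} \<subseteq> {a \<in> int_vectors N. \<forall>i. - int K \<le> Poly_Mapping.lookup a i
          \<and> Poly_Mapping.lookup a i \<le> Poly_Mapping.lookup m i + int K}"
  proof safe
    fix a i assume nz: "f a \<noteq> 0" "g (m - a) \<noteq> 0"
    show "a \<in> int_vectors N" "- int K \<le> Poly_Mapping.lookup a i"
      using laurent_boundD[OF assms(1) nz(1)] by auto
    show "Poly_Mapping.lookup a i \<le> Poly_Mapping.lookup m i + int K"
      using laurent_boundD(2)[OF assms(2) nz(2), of i] by (simp add: lookup_minus)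
  qed
qed

definition laurent_mult ::
  "((nat \<Rightarrow>\<^sub>0 int) \<Rightarrow> 'a) \<Rightarrow> ((nat \<Rightarrow>\<^sub>0 int) \<Rightarrow> 'a) \<Rightarrow> (nat \<Rightarrow>\<^sub>0 int) \<Rightarrow> 'a::comm_ring_1" where
  "laurent_mult f g m = (\<Sum>a \<in> {a. f a \<noteq> 0 \<and> g (m - a) \<noteq> 0}. f a * g (m - a))"

lemma laurent_mult_superset:
  assumes "finite S" "{a. f a \<noteq> 0 \<and> g (m - a) \<noteq> 0} \<subseteq> S"
  shows "laurent_mult f g m = (\<Sum>a\<in>S. f a * g (m - a))"
  unfolding laurent_mult_def by (rule sum.mono_neutral_left) (use assms in auto)

lemma laurent_mult_nonzero:
  assumes "laurent_mult f g m \<noteq> 0"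
  obtains a where "f a \<noteq> 0" "g (m - a) \<noteq> 0"
  using assms unfolding laurent_mult_def
  by (elim sum.not_neutral_contains_not_neutral) auto

lemma laurent_bound_mult:
  assumes "laurent_bound N K f" "laurent_bound N K g"
  shows "laurent_bound N (2 * K) (laurent_mult f g)"
  unfolding laurent_bound_def
proof safe
  fix m i assume "laurent_mult f g m \<noteq> 0"
  then obtain a where a: "f a \<noteq> 0" "g (m - a) \<noteq> 0" by (rule laurent_mult_nonzero)
  have "a + (m - a) \<in> int_vectors N"
    by (intro int_vectors_add laurent_boundD(1)[OF assms(1)] laurent_boundD(1)[OF assms(2)] a)
  then show "m \<in> int_vectors N" by simp
  show "- int (2 * K) \<le> Poly_Mapping.lookup m i"
    using laurent_boundD(2)[OF assms(1) a(1), of i] laurent_boundD(2)[OF assms(2) a(2), of i]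
    by (simp add: lookup_minus)
qed

lemma laurent_mult_commute:
  fixes f g :: "(nat \<Rightarrow>\<^sub>0 int) \<Rightarrow> 'a::comm_ring_1"
  shows "laurent_mult f g m = laurent_mult g f m"
  unfolding laurent_mult_def
  by (rule sum.reindex_bij_witness[of _ "\<lambda>a. m - a" "\<lambda>a. m - a"]) (auto simp: mult.commute)

lemma laurent_mult_assoc:
  assumes "laurent_bound N K f" "laurent_bound N K g" "laurent_bound N K h"
  shows "laurent_mult (laurent_mult f g) h m = laurent_mult f (laurent_mult g h) m"
proof -
  let ?l = "Poly_Mapping.lookup"
  define B where "B = {a \<in> int_vectors N. \<forall>i. - int (2 * K) \<le> ?l a i \<and> ?l a i \<le> ?l m i + int (2 * K)}"
  have finB: "finite B" unfolding B_def by (rule finite_int_vectors_box)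
  have inB: "a \<in> B"
    if "a \<in> int_vectors N" "\<And>i. - int (2 * K) \<le> ?l a i" "\<And>i. - int (2 * K) \<le> ?l (m - a) i" for a
    unfolding B_def
  proof (intro CollectI conjI allI that(1))
    fix i show "- int (2 * K) \<le> ?l a i" by (rule that(2))
    show "?l a i \<le> ?l m i + int (2 * K)" using that(3)[of i] by (simp add: lookup_minus)
  qed
  note gh = laurent_bound_mult[OF assms(2,3)]
  note fg = laurent_bound_mult[OF assms(1,2)]
  note f2 = laurent_bound_mono[OF assms(1) order_refl, of "2 * K"]
  note g2 = laurent_bound_mono[OF assms(2) order_refl, of "2 * K"]
  note h2 = laurent_bound_mono[OF assms(3) order_refl, of "2 * K"]
  define T where "T = {(b, c). f b \<noteq> 0 \<and> g c \<noteq> 0 \<and> h (m - b - c) \<noteq> 0}"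
  have T1: "b \<in> B" "c \<in> B" "b + c \<in> B" if "(b, c) \<in> T" for b c
  proof -
    from that have nz: "f b \<noteq> 0" "g c \<noteq> 0" "h (m - b - c) \<noteq> 0" by (auto simp: T_def)
    have l: "- int K \<le> ?l b i" "- int K \<le> ?l c i" "- int K \<le> ?l m i - ?l b i - ?l c i" for i
      using laurent_boundD(2)[OF assms(1) nz(1), of i] laurent_boundD(2)[OF assms(2) nz(2), of i]
        laurent_boundD(2)[OF assms(3) nz(3), of i] by (simp_all add: lookup_minus)
    have v: "b \<in> int_vectors N" "c \<in> int_vectors N"
      using laurent_boundD(1)[OF assms(1) nz(1)] laurent_boundD(1)[OF assms(2) nz(2)] by auto
    show "b \<in> B"
    proof (rule inB)
      fix i show "- int (2 * K) \<le> ?l b i" "- int (2 * K) \<le> ?l (m - b) i"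
        using l[of i] by (simp_all add: lookup_minus)
    qed (fact v)
    show "c \<in> B"
    proof (rule inB)
      fix i show "- int (2 * K) \<le> ?l c i" "- int (2 * K) \<le> ?l (m - c) i"
        using l[of i] by (simp_all add: lookup_minus)
    qed (fact v)
    show "b + c \<in> B"
    proof (rule inB)
      fix i show "- int (2 * K) \<le> ?l (b + c) i" "- int (2 * K) \<le> ?l (m - (b + c)) i"
        using l[of i] by (simp_all add: lookup_minus lookup_add)
    qed (intro int_vectors_add v)
  qed
  have "laurent_mult (laurent_mult f g) h m = (\<Sum>a\<in>B. laurent_mult f g a * h (m - a))"
  proof (rule laurent_mult_superset[OF finB], safe)
    fix a assume nz: "laurent_mult f g a \<noteq> 0" "h (m - a) \<noteq> 0"
    show "a \<in> B"
      by (rule inB) (use laurent_boundD[OF fg nz(1)] laurent_boundD[OF h2 nz(2)] in auto)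
  qed
  also have "\<dots> = (\<Sum>a\<in>B. \<Sum>b\<in>B. f b * g (a - b) * h (m - a))"
  proof (rule sum.cong[OF refl])
    fix a assume a: "a \<in> B"
    have "laurent_mult f g a * h (m - a) = (\<Sum>b \<in> {b. f b \<noteq> 0 \<and> g (a - b) \<noteq> 0}. f b * g (a - b) * h (m - a))"
      by (simp add: laurent_mult_def sum_distrib_right)
    also have "\<dots> = (\<Sum>b\<in>B. f b * g (a - b) * h (m - a))"
    proof (rule sum.mono_neutral_cong[OF finB finite_laurent_support[OF assms(1,2)]])
      fix b assume b: "b \<in> {b. f b \<noteq> 0 \<and> g (a - b) \<noteq> 0} - B"
      have "(b, a - b) \<notin> T" using T1(1) b by auto
      moreover have "m - b - (a - b) = m - a" by simp
      ultimately show "f b * g (a - b) * h (m - a) = 0" using b by (auto simp: T_def)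
    qed auto
    finally show "laurent_mult f g a * h (m - a) = (\<Sum>b\<in>B. f b * g (a - b) * h (m - a))" .
  qed
  also have "\<dots> = (\<Sum>(a, b)\<in>B \<times> B. f b * g (a - b) * h (m - a))"
    by (simp add: sum.cartesian_product)
  also have "\<dots> = (\<Sum>(a, b)\<in>{(a, b). (b, a - b) \<in> T}. f b * g (a - b) * h (m - a))"
  proof (rule sum.mono_neutral_right)
    show "finite (B \<times> B)" using finB by simp
    show "{(a, b). (b, a - b) \<in> T} \<subseteq> B \<times> B"
    proof safe
      fix a b assume t: "(b, a - b) \<in> T"
      show "b \<in> B" by (rule T1(1)[OF t])
      show "a \<in> B" using T1(3)[OF t] by simp
    qed
    have "m - b - (a - b) = m - a" for a b by simp
    then show "\<forall>p \<in> B \<times> B - {(a, b). (b, a - b) \<in> T}.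
            (case p of (a, b) \<Rightarrow> f b * g (a - b) * h (m - a)) = 0"
      by (auto simp: T_def)
  qed
  also have "\<dots> = (\<Sum>(b, c)\<in>T. f b * g c * h (m - b - c))"
    by (rule sum.reindex_bij_witness[of _ "\<lambda>(b, c). (b + c, b)" "\<lambda>(a, b). (b, a - b)"])
      (simp_all add: split_beta diff_diff_eq)
  also have "\<dots> = (\<Sum>(b, c)\<in>B \<times> B. f b * g c * h (m - b - c))"
  proof (rule sum.mono_neutral_left)
    show "finite (B \<times> B)" using finB by simp
    show "T \<subseteq> B \<times> B" using T1(1,2) by auto
  qed (auto simp: T_def)
  also have "\<dots> = (\<Sum>b\<in>B. \<Sum>c\<in>B. f b * g c * h (m - b - c))"
    by (simp add: sum.cartesian_product)
  also have "\<dots> = (\<Sum>b\<in>B. f b * laurent_mult g h (m - b))"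
  proof (rule sum.cong[OF refl])
    fix b assume b: "b \<in> B"
    have "f b * laurent_mult g h (m - b) =
        (\<Sum>c \<in> {c. g c \<noteq> 0 \<and> h (m - b - c) \<noteq> 0}. f b * g c * h (m - b - c))"
      by (simp add: laurent_mult_def sum_distrib_left mult.assoc)
    also have "\<dots> = (\<Sum>c\<in>B. f b * g c * h (m - b - c))"
    proof (rule sum.mono_neutral_cong[OF finB finite_laurent_support[OF assms(2,3)]])
      fix c assume c: "c \<in> {c. g c \<noteq> 0 \<and> h (m - b - c) \<noteq> 0} - B"
      have "(b, c) \<notin> T" using T1(2) c by auto
      then show "f b * g c * h (m - b - c) = 0" using c by (auto simp: T_def)
    qed auto
    finally show "(\<Sum>c\<in>B. f b * g c * h (m - b - c)) = f b * laurent_mult g h (m - b)" by simp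
  qed
  also have "\<dots> = laurent_mult f (laurent_mult g h) m"
  proof (rule laurent_mult_superset[OF finB, symmetric], safe)
    fix a assume nz: "f a \<noteq> 0" "laurent_mult g h (m - a) \<noteq> 0"
    show "a \<in> B"
      by (rule inB) (use laurent_boundD[OF f2 nz(1)] laurent_boundD[OF gh nz(2)] in auto)
  qed
  finally show ?thesis .
qed

lemma laurent_mult_add:
  assumes "laurent_bound N K f" "laurent_bound N K g" "laurent_bound N K h"
  shows "laurent_mult (\<lambda>a. f a + g a) h m = laurent_mult f h m + laurent_mult g h m"
proof -
  let ?S = "{a. f a \<noteq> 0 \<and> h (m - a) \<noteq> 0} \<union> {a. g a \<noteq> 0 \<and> h (m - a) \<noteq> 0}"
  have fin: "finite ?S" using assms by (blast intro: finite_laurent_support)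
  have "laurent_mult (\<lambda>a. f a + g a) h m = (\<Sum>a\<in>?S. (f a + g a) * h (m - a))"
    by (rule laurent_mult_superset[OF fin]) auto
  moreover have "laurent_mult f h m = (\<Sum>a\<in>?S. f a * h (m - a))"
    by (rule laurent_mult_superset[OF fin]) auto
  moreover have "laurent_mult g h m = (\<Sum>a\<in>?S. g a * h (m - a))"
    by (rule laurent_mult_superset[OF fin]) auto
  ultimately show ?thesis by (simp add: algebra_simps sum.distrib)
qed

instantiation mlaurent :: (comm_ring_1) comm_ring_1
begin

lift_definition zero_mlaurent :: "'a mlaurent" is "\<lambda>_. 0"
  by (auto simp: laurent_bound_def)

lift_definition one_mlaurent :: "'a mlaurent" is "\<lambda>m. if m = 0 then 1 else 0"
  by (auto simp: laurent_bound_def int_vectors_def)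

lift_definition plus_mlaurent :: "'a mlaurent \<Rightarrow> 'a mlaurent \<Rightarrow> 'a mlaurent"
  is "\<lambda>f g m. f m + g m"
proof -
  fix f g :: "(nat \<Rightarrow>\<^sub>0 int) \<Rightarrow> 'a"
  assume "\<exists>N K. laurent_bound N K f" "\<exists>N K. laurent_bound N K g"
  then obtain N K where "laurent_bound N K f" "laurent_bound N K g" by (rule laurent_bound_common)
  then have "laurent_bound N K (\<lambda>m. f m + g m)"
    unfolding laurent_bound_def by (metis add_0)
  then show "\<exists>N K. laurent_bound N K (\<lambda>m. f m + g m)" by blast
qed

lift_definition uminus_mlaurent :: "'a mlaurent \<Rightarrow> 'a mlaurent" is "\<lambda>f m. - f m"
  by (simp add: laurent_bound_def)

lift_definition minus_mlaurent :: "'a mlaurent \<Rightarrow> 'a mlaurent \<Rightarrow> 'a mlaurent"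
  is "\<lambda>f g m. f m - g m"
proof -
  fix f g :: "(nat \<Rightarrow>\<^sub>0 int) \<Rightarrow> 'a"
  assume "\<exists>N K. laurent_bound N K f" "\<exists>N K. laurent_bound N K g"
  then obtain N K where "laurent_bound N K f" "laurent_bound N K g" by (rule laurent_bound_common)
  then have "laurent_bound N K (\<lambda>m. f m - g m)"
    unfolding laurent_bound_def by (metis diff_0_right)
  then show "\<exists>N K. laurent_bound N K (\<lambda>m. f m - g m)" by blast
qed

lift_definition times_mlaurent :: "'a mlaurent \<Rightarrow> 'a mlaurent \<Rightarrow> 'a mlaurent"
  is laurent_mult
  by (meson laurent_bound_common laurent_bound_mult)

instance
proof
  fix a b c :: "'a mlaurent"
  obtain Na Ka Nb Kb Nc Kc where
    "laurent_bound Na Ka (mlcoeff a)" "laurent_bound Nb Kb (mlcoeff b)" "laurent_bound Nc Kc (mlcoeff c)"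
    using mlcoeff[of a] mlcoeff[of b] mlcoeff[of c] by auto
  then obtain N K where *:
    "laurent_bound N K (mlcoeff a)" "laurent_bound N K (mlcoeff b)" "laurent_bound N K (mlcoeff c)"
    using that[of "Na + Nb + Nc" "Ka + Kb + Kc"] by (simp add: laurent_bound_mono)
  show "a * b * c = a * (b * c)"
    by (rule mlaurent_eqI) (simp add: times_mlaurent.rep_eq laurent_mult_assoc[OF *])
  show "a * b = b * a"
    by (rule mlaurent_eqI) (simp add: times_mlaurent.rep_eq laurent_mult_commute)
  show "(a + b) * c = a * c + b * c"
    by (rule mlaurent_eqI)
      (simp add: times_mlaurent.rep_eq plus_mlaurent.rep_eq laurent_mult_add[OF *])
  show "1 * a = a"
  proof (rule mlaurent_eqI)
    fix m
    have "mlcoeff (1 * a) m = (\<Sum>b\<in>{0}. mlcoeff 1 b * mlcoeff a (m - b))"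
      unfolding times_mlaurent.rep_eq
      by (rule laurent_mult_superset) (auto simp: one_mlaurent.rep_eq split: if_splits)
    then show "mlcoeff (1 * a) m = mlcoeff a m" by (simp add: one_mlaurent.rep_eq)
  qed
  show "(0::'a mlaurent) \<noteq> 1"
    by (metis one_mlaurent.rep_eq zero_mlaurent.rep_eq zero_neq_one)
qed (rule mlaurent_eqI;
     simp add: plus_mlaurent.rep_eq minus_mlaurent.rep_eq uminus_mlaurent.rep_eq
       zero_mlaurent.rep_eq algebra_simps)+

end

definition laurent_ring :: "nat \<Rightarrow> 'a::zero mlaurent set" where
  "laurent_ring N = {f. \<forall>m. mlcoeff f m \<noteq> 0 \<longrightarrow> m \<in> int_vectors N}"

text \<open>The term \<open>c t\<^sup>m\<close>.\<close>

definition ml_monom :: "'a::zero \<Rightarrow> (nat \<Rightarrow>\<^sub>0 int) \<Rightarrow> 'a mlaurent" where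
  "ml_monom c m = Abs_mlaurent (\<lambda>m'. if m' = m then c else 0)"

lemma mlcoeff_ml_monom: "mlcoeff (ml_monom c m) m' = (if m' = m then c else 0)"
proof -
  define K where "K = nat (\<Sum>i\<in>Poly_Mapping.keys m. \<bar>Poly_Mapping.lookup m i\<bar>)"
  have "- int K \<le> Poly_Mapping.lookup m i" for i
  proof (cases "i \<in> Poly_Mapping.keys m")
    case True
    then have "\<bar>Poly_Mapping.lookup m i\<bar> \<le> (\<Sum>i\<in>Poly_Mapping.keys m. \<bar>Poly_Mapping.lookup m i\<bar>)"
      by (intro member_le_sum) auto
    then show ?thesis by (simp add: K_def)
  qed (simp add: in_keys_iff)
  moreover obtain N where "Poly_Mapping.keys m \<subseteq> {..<N}"
    using finite_nat_bounded[of "Poly_Mapping.keys m"] by auto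
  ultimately have "laurent_bound N K (\<lambda>m'. if m' = m then c else 0)"
    by (auto simp: laurent_bound_def int_vectors_def)
  then show ?thesis
    unfolding ml_monom_def by (subst Abs_mlaurent_inverse) auto
qed

lift_definition ml_of_int :: "int mlaurent \<Rightarrow> complex mlaurent" is "\<lambda>f m. of_int (f m)"
  by (simp add: laurent_bound_def)

text \<open>The substitution \<open>t\<^sub>i \<mapsto> t\<^sub>i\<^sup>d\<close> for \<open>d \<ge> 1\<close>.\<close>

lift_definition ml_subst_power :: "nat \<Rightarrow> 'a::zero mlaurent \<Rightarrow> 'a mlaurent"
  is "\<lambda>d f m. if \<forall>i. int d dvd Poly_Mapping.lookup m i
              then f (Poly_Mapping.map (\<lambda>k. k div int d) m) else 0"
proof -
  fix d and f :: "(nat \<Rightarrow>\<^sub>0 int) \<Rightarrow> 'a"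
  let ?l = "Poly_Mapping.lookup"
  let ?q = "Poly_Mapping.map (\<lambda>k. k div int d)"
  assume "\<exists>N K. laurent_bound N K f"
  then obtain N K where b: "laurent_bound N K f" by blast
  have "laurent_bound N (d * K) (\<lambda>m. if \<forall>i. int d dvd ?l m i then f (?q m) else 0)"
    unfolding laurent_bound_def
  proof safe
    fix m i assume "(if \<forall>i. int d dvd ?l m i then f (?q m) else 0) \<noteq> 0"
    then have dv: "\<forall>i. int d dvd ?l m i" and nz: "f (?q m) \<noteq> 0" by (auto split: if_splits)
    have l: "?l m j = int d * ?l (?q m) j" for j
      using dv by (simp add: Poly_Mapping.map.rep_eq when_def)
    have "Poly_Mapping.keys m \<subseteq> Poly_Mapping.keys (?q m)"
      using l by (auto simp: in_keys_iff)
    then show "m \<in> int_vectors N"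
      using laurent_boundD(1)[OF b nz] by (auto simp: int_vectors_def)
    have "int d * (- int K) \<le> int d * ?l (?q m) i"
      by (intro mult_left_mono laurent_boundD(2)[OF b nz]) simp
    then show "- int (d * K) \<le> ?l m i" using l[of i] by simp
  qed
  then show "\<exists>N K. laurent_bound N K (\<lambda>m. if \<forall>i. int d dvd ?l m i then f (?q m) else 0)" by blast
qed


section \<open>Integer powers and infinite products of formal series\<close>

text \<open>For negative \<open>k\<close> this is meaningful only when \<open>a\<close> is a unit.\<close>

definition unit_powi :: "'a::comm_ring_1 \<Rightarrow> int \<Rightarrow> 'a" where
  "unit_powi a k = (if k \<ge> 0 then a ^ nat k else (THE b. a * b = 1) ^ nat (- k))"

text \<open>
  Unconditional convergence of an infinite product, coefficient by coefficient: \<open>\<kappa> j P\<close> is the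
  coefficient of \<open>P\<close> with index \<open>j\<close>, and each coefficient of the finite partial products is
  eventually constant.
\<close>

definition formal_has_prod ::
  "('j \<Rightarrow> 'r::comm_monoid_mult \<Rightarrow> 'b) \<Rightarrow> ('i \<Rightarrow> 'r) \<Rightarrow> 'i set \<Rightarrow> 'r \<Rightarrow> bool" where
  "formal_has_prod \<kappa> f A P \<longleftrightarrow>
     (\<forall>j. \<forall>\<^sub>F F in finite_subsets_at_top A. \<kappa> j (\<Prod>i\<in>F. f i) = \<kappa> j P)"

text \<open>Coefficient of \<open>T\<^sup>n t\<^sup>a\<close>, respectively of \<open>T\<^sup>n u\<^sup>k t\<^sup>a\<close>.\<close>

definition coeff_Tt :: "nat \<times> (nat \<Rightarrow>\<^sub>0 int) \<Rightarrow> 'a::zero mlaurent fps \<Rightarrow> 'a" where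
  "coeff_Tt = (\<lambda>(n, a) P. mlcoeff (fps_nth P n) a)"

definition coeff_Tut ::
  "nat \<times> nat \<times> (nat \<Rightarrow>\<^sub>0 int) \<Rightarrow> 'a::comm_ring_1 mlaurent poly fps \<Rightarrow> 'a" where
  "coeff_Tut = (\<lambda>(n, k, a) P. mlcoeff (Polynomial.coeff (fps_nth P n) k) a)"


section \<open>Varieties over a finite field\<close>

text \<open>
  The finite field is the type \<open>'f\<close>, with \<open>q = CARD('f)\<close>, and \<open>'f alg_closure\<close> is its algebraic
  closure. Points of affine \<open>n\<close>-space over the closure are sequences vanishing from index \<open>n\<close> on, so
  a polynomial over \<open>'f\<close> in arbitrarily many variables restricts to one in the first \<open>n\<close> variables.
\<close>

type_synonym 'f mpolynomial = "(nat \<Rightarrow>\<^sub>0 nat) \<Rightarrow>\<^sub>0 'f"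

definition mpeval :: "'f::field mpolynomial \<Rightarrow> (nat \<Rightarrow> 'f alg_closure) \<Rightarrow> 'f alg_closure" where
  "mpeval p x = (\<Sum>e\<in>Poly_Mapping.keys p. to_ac (Poly_Mapping.lookup p e) *
     (\<Prod>i\<in>Poly_Mapping.keys e. x i ^ Poly_Mapping.lookup e i))"

definition affine_space :: "nat \<Rightarrow> (nat \<Rightarrow> 'f::field alg_closure) set" where
  "affine_space n = {x. \<forall>i\<ge>n. x i = 0}"

definition zariski_closed :: "nat \<Rightarrow> (nat \<Rightarrow> 'f::field alg_closure) set \<Rightarrow> bool" where
  "zariski_closed n V \<longleftrightarrow>
     (\<exists>S :: 'f mpolynomial set. V = {x \<in> affine_space n. \<forall>p\<in>S. mpeval p x = 0})"

definition join_coords :: "nat \<Rightarrow> (nat \<Rightarrow> 'a) \<Rightarrow> (nat \<Rightarrow> 'a) \<Rightarrow> nat \<Rightarrow> 'a" where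
  "join_coords n x y = (\<lambda>i. if i < n then x i else y (i - n))"

text \<open>
  A variety over \<open>'f\<close> (a reduced separated scheme of finite type, not necessarily irreducible) is
  described by its set of points over the algebraic closure together with a finite affine atlas
  defined over \<open>'f\<close>: each chart identifies a subset of the points with an affine algebraic set
  defined over \<open>'f\<close>, chart overlaps are open, the coordinate changes are regular, and the
  variety is separated (overlaps are closed in the products of charts), all over \<open>'f\<close>.
\<close>

record (overloaded) ('f::field, 'p) chart =
  chart_dom :: "'p set"
  chart_dim :: nat
  chart_coord :: "'p \<Rightarrow> nat \<Rightarrow> 'f alg_closure"

definition affine_chart :: "('f::field, 'p) chart \<Rightarrow> bool" where
  "affine_chart c \<longleftrightarrow> inj_on (chart_coord c) (chart_dom c) \<and>
     zariski_closed (chart_dim c) (chart_coord c ` chart_dom c)"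

definition open_overlap :: "('f::field, 'p) chart \<Rightarrow> ('f, 'p) chart \<Rightarrow> bool" where
  "open_overlap c c' \<longleftrightarrow> (\<exists>Z. zariski_closed (chart_dim c) Z \<and>
     chart_coord c ` (chart_dom c \<inter> chart_dom c') = chart_coord c ` chart_dom c - Z)"

text \<open>
  Regularity is local: near each point of the overlap, every coordinate of \<open>c'\<close> is a quotient of
  polynomials over \<open>'f\<close> in the coordinates of \<open>c\<close>.
\<close>

definition regular_transition :: "('f::field, 'p) chart \<Rightarrow> ('f, 'p) chart \<Rightarrow> bool" where
  "regular_transition c c' \<longleftrightarrow>
     (\<forall>x \<in> chart_dom c \<inter> chart_dom c'. \<forall>j < chart_dim c'. \<exists>g h :: 'f mpolynomial.
        mpeval h (chart_coord c x) \<noteq> 0 \<and>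
        (\<forall>y \<in> chart_dom c \<inter> chart_dom c'. mpeval h (chart_coord c y) \<noteq> 0 \<longrightarrow>
           chart_coord c' y j = mpeval g (chart_coord c y) / mpeval h (chart_coord c y)))"

definition separated_overlap :: "('f::field, 'p) chart \<Rightarrow> ('f, 'p) chart \<Rightarrow> bool" where
  "separated_overlap c c' \<longleftrightarrow> zariski_closed (chart_dim c + chart_dim c')
     ((\<lambda>x. join_coords (chart_dim c) (chart_coord c x) (chart_coord c' x)) `
        (chart_dom c \<inter> chart_dom c'))"

definition variety :: "('f::field, 'p) chart set \<Rightarrow> bool" where
  "variety V \<longleftrightarrow> finite V \<and> (\<forall>c\<in>V. affine_chart c) \<and>
     (\<forall>c\<in>V. \<forall>c'\<in>V. open_overlap c c' \<and> regular_transition c c' \<and> separated_overlap c c')"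

definition points :: "('f::field, 'p) chart set \<Rightarrow> 'p set" where
  "points V = (\<Union>c\<in>V. chart_dom c)"

text \<open>The elements with \<open>a\<^bsup>q^r\<^esup> = a\<close> form the subfield with \<open>q\<^sup>r\<close> elements of the closure.\<close>

definition rational_points :: "('f::{field,finite}, 'p) chart set \<Rightarrow> nat \<Rightarrow> 'p set" where
  "rational_points V r =
     {x. \<exists>c\<in>V. x \<in> chart_dom c \<and> (\<forall>i. chart_coord c x i ^ (CARD('f) ^ r) = chart_coord c x i)}"

definition frob :: "('f::{field,finite}, 'p) chart set \<Rightarrow> 'p \<Rightarrow> 'p" where
  "frob V x = (THE y. \<exists>c\<in>V. x \<in> chart_dom c \<and> y \<in> chart_dom c \<and>
     (\<forall>i. chart_coord c y i = chart_coord c x i ^ CARD('f)))"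

definition zeta :: "('f::{field,finite}, 'p) chart set \<Rightarrow> complex fps" where
  "zeta V = fps_exp 1 oo
     Abs_fps (\<lambda>r. if r = 0 then 0 else of_nat (card (rational_points V r)) / of_nat r)"


section \<open>Colorings\<close>

record 'c coloring_data =
  colors :: "'c set"
  cdeg :: "'c \<Rightarrow> nat"
  weight :: "'c \<Rightarrow> int mlaurent"

definition is_coloring_data :: "nat \<Rightarrow> 'c coloring_data \<Rightarrow> bool" where
  "is_coloring_data N C \<longleftrightarrow>
     (\<forall>n. finite {c \<in> colors C. cdeg C c = n}) \<and>
     (\<exists>!c. c \<in> colors C \<and> cdeg C c = 0) \<and>
     (\<forall>c \<in> colors C. weight C c \<in> laurent_ring N) \<and>
     (\<forall>c \<in> colors C. cdeg C c = 0 \<longrightarrow> weight C c = 1)"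

definition zero_color :: "'c coloring_data \<Rightarrow> 'c" where
  "zero_color C = (THE c. c \<in> colors C \<and> cdeg C c = 0)"

definition color_support ::
  "('f::{field,finite}, 'p) chart set \<Rightarrow> 'c coloring_data \<Rightarrow> ('p \<Rightarrow> 'c) \<Rightarrow> 'p set" where
  "color_support V C \<Lambda> = {x \<in> points V. \<Lambda> x \<noteq> zero_color C}"

definition colorings ::
  "('f::{field,finite}, 'p) chart set \<Rightarrow> 'c coloring_data \<Rightarrow> ('p \<Rightarrow> 'c) set" where
  "colorings V C = {\<Lambda> \<in> points V \<rightarrow>\<^sub>E colors C. finite (color_support V C \<Lambda>)}"

definition frob_colorings ::
  "('f::{field,finite}, 'p) chart set \<Rightarrow> 'c coloring_data \<Rightarrow> ('p \<Rightarrow> 'c) set" where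
  "frob_colorings V C = {\<Lambda> \<in> colorings V C. \<forall>x \<in> points V. \<Lambda> (frob V x) = \<Lambda> x}"

text \<open>
  Points outside the support contribute 0 to the degree, and orbits outside it contribute the factor
  \<open>W(0) = 1\<close> to the weight; leaving them out makes the sum and the product finite. A coloring over
  \<open>'f\<close> is constant on each orbit \<open>o\<close>, and \<open>the_elem (\<Lambda> ` o)\<close> is its value there.
\<close>

definition coloring_degree ::
  "('f::{field,finite}, 'p) chart set \<Rightarrow> 'c coloring_data \<Rightarrow> ('p \<Rightarrow> 'c) \<Rightarrow> nat" where
  "coloring_degree V C \<Lambda> = (\<Sum>x \<in> color_support V C \<Lambda>. cdeg C (\<Lambda> x))"

definition coloring_weight ::
  "('f::{field,finite}, 'p) chart set \<Rightarrow> 'c coloring_data \<Rightarrow> ('p \<Rightarrow> 'c) \<Rightarrow> int mlaurent" where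
  "coloring_weight V C \<Lambda> = (\<Prod>orb \<in> orbit (frob V) ` color_support V C \<Lambda>.
     ml_subst_power (card orb) (weight C (the_elem (\<Lambda> ` orb))))"

text \<open>There are only finitely many colorings over \<open>'f\<close> of each degree.\<close>

definition coloring_zeta ::
  "('f::{field,finite}, 'p) chart set \<Rightarrow> 'c coloring_data \<Rightarrow> int mlaurent fps" where
  "coloring_zeta V C = Abs_fps (\<lambda>n.
     \<Sum>\<Lambda> \<in> {\<Lambda> \<in> frob_colorings V C. coloring_degree V C \<Lambda> = n}. coloring_weight V C \<Lambda>)"

definition coloring_zeta_point :: "'c coloring_data \<Rightarrow> int mlaurent fps" where
  "coloring_zeta_point C = Abs_fps (\<lambda>n. \<Sum>c \<in> {c \<in> colors C. cdeg C c = n}. weight C c)"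

definition product_index :: "nat \<Rightarrow> (nat \<times> (nat \<Rightarrow>\<^sub>0 int)) set" where
  "product_index N = {1..} \<times> int_vectors N"

text \<open>
  The integers \<open>v d m\<close> are the exponents in the product expansion of \<open>coloring_zeta_point C\<close>; for
  each \<open>d\<close>, the series with coefficients \<open>v d m\<close> is required to be a Laurent series.
\<close>

definition product_exponents ::
  "nat \<Rightarrow> 'c coloring_data \<Rightarrow> (nat \<Rightarrow> (nat \<Rightarrow>\<^sub>0 int) \<Rightarrow> int) \<Rightarrow> bool" where
  "product_exponents N C v \<longleftrightarrow>
     (\<forall>d\<ge>1. \<exists>f \<in> laurent_ring N. \<forall>m \<in> int_vectors N. mlcoeff f m = v d m) \<and>
     formal_has_prod coeff_Tt
       (\<lambda>(d, m). unit_powi (1 - fps_const (ml_monom 1 m) * fps_X ^ d) (- v d m))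
       (product_index N) (coloring_zeta_point C)"

text \<open>
  The series \<open>Z\<^sub>C(u, t, T)\<close>: a power series in \<open>T\<close> whose coefficients are polynomials in \<open>u\<close> over the
  Laurent series; \<open>Polynomial.monom (ml_monom 1 m) 1\<close> is \<open>u t\<^sup>m\<close>.
\<close>

definition coloring_zeta_u ::
  "nat \<Rightarrow> (nat \<Rightarrow> (nat \<Rightarrow>\<^sub>0 int) \<Rightarrow> int) \<Rightarrow> int mlaurent poly fps" where
  "coloring_zeta_u N v = (THE P. formal_has_prod coeff_Tut
     (\<lambda>(d, m). unit_powi (1 - fps_const (Polynomial.monom (ml_monom 1 m) 1) * fps_X ^ d) (- v d m))
     (product_index N) P)"

definition fps_ml_of_int :: "int mlaurent fps \<Rightarrow> complex mlaurent fps" where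
  "fps_ml_of_int P = Abs_fps (\<lambda>n. ml_of_int (fps_nth P n))"

definition specialize_u :: "complex \<Rightarrow> int mlaurent poly fps \<Rightarrow> complex mlaurent fps" where
  "specialize_u x P = Abs_fps (\<lambda>n. poly (map_poly ml_of_int (fps_nth P n)) (ml_monom x 0))"

end

theory Submission
  imports Defs
begin

text \<open>
  Both sides of the identity are power series in \<open>T\<close> with constant coefficient 1 over a ring without
  additive torsion, so each is determined by its logarithmic derivative with respect to \<open>T d/dT\<close>
  (\<open>has_dlog_unique\<close>). It suffices to compare these.

  Let \<open>A\<^sub>d\<close> be the Laurent series with coefficients \<open>v d m\<close>. The factor of \<open>Z\<^sub>C(u, t, T)\<close> with indices
  \<open>d\<close> and \<open>m\<close> has the logarithmic derivative \<open>v d m \<Sum>\<^sub>k d u\<^sup>k t\<^sup>k\<^sup>m T\<^sup>d\<^sup>k\<close> (\<open>k \<ge> 1\<close>). Summing over \<open>m\<close> gives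
  \<open>\<Sum>\<^sub>k d u\<^sup>k A\<^sub>d(t\<^sup>k) T\<^sup>d\<^sup>k\<close>, so the coefficient of \<open>T\<^sup>n\<close> in the logarithmic derivative of \<open>Z\<^sub>C(u, t, T)\<close> is
  the sum of \<open>d u\<^sup>n\<^sup>/\<^sup>d A\<^sub>d(t\<^sup>n\<^sup>/\<^sup>d)\<close> over the divisors \<open>d\<close> of \<open>n\<close>. That the infinite product converges at all,
  and that it may be differentiated factor by factor, is shown by a limit argument: the recursion
  \<open>n p\<^sub>n = \<Sum>\<^sub>j p\<^sub>j L\<^sub>n\<^sub>-\<^sub>j\<close> for a series with logarithmic derivative \<open>L\<close> carries convergence with uniform bounds from
  the logarithmic derivatives to the series (\<open>dlog_limit\<close>, \<open>coloring_zeta_u_dlog\<close>). At \<open>u = 1\<close> the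
  series is \<open>Z\<^sub>C\<close> of a point.

  A coloring over the finite field is a choice of a color for each closed point of \<open>X\<close>, that is, for
  each finite Frobenius orbit, with all but finitely many colors equal to 0. Hence \<open>Z\<^sub>C(X, t, T)\<close> is
  the product over the closed points of
  \<open>Z\<^sub>C(\<bullet>, t\<^sup>d, T\<^sup>d)\<close>, with \<open>d\<close> the degree of the point (\<open>coloring_zeta_nth\<close>). The points over the
  extension of degree \<open>r\<close> are counted by \<open>N\<^sub>r\<close>, the sum of the degrees of the closed points whose degree
  divides \<open>r\<close>. So the logarithmic derivative of the product has the same shape as that of \<open>Z\<^sub>C(u, t, T)\<close>, with \<open>N\<^sub>k\<close> in
  the place of \<open>u\<^sup>k\<close> (\<open>has_dlog_coloring_zeta\<close>). Finally, the factorization of the zeta function says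
  that \<open>N\<^sub>k = \<Sum>\<^sub>i n\<^sub>i x\<^sub>i\<^sup>k\<close> (\<open>card_rational_points_eq\<close>), which is what the product over \<open>i\<close> of the
  series \<open>Z\<^sub>C(x\<^sub>i, t, T)\<close> with exponents \<open>n\<^sub>i\<close> gives.

  The geometry enters only through three facts about the Frobenius map: it is well defined and
  injective on the points, its \<open>r\<close>-th iterate fixes exactly the points counted by \<open>N\<^sub>r\<close>, and these are
  finitely many. The first two rest on the additivity of \<open>x \<mapsto> x\<^sup>q\<close> on the algebraic closure, by which this
  map commutes with polynomials over the finite field.
\<close>

section \<open>Ring homomorphisms and logarithmic derivatives\<close>

text \<open>Unital homomorphisms between commutative rings given by type classes.\<close>

locale cring_hom =
  fixes h :: "'a::comm_ring_1 \<Rightarrow> 'b::comm_ring_1"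
  assumes hom_one [simp]: "h 1 = 1"
    and hom_add: "h (a + b) = h a + h b"
    and hom_mult: "h (a * b) = h a * h b"
begin

lemma hom_zero [simp]: "h 0 = 0"
  using hom_add[of 0 0] by simp

lemma hom_uminus: "h (- a) = - h a"
  using hom_add[of a "- a"] by (simp add: eq_neg_iff_add_eq_0 add.commute)

lemma hom_diff: "h (a - b) = h a - h b"
  using hom_add[of a "- b"] by (simp add: hom_uminus)

lemma hom_sum: "h (sum f A) = (\<Sum>a\<in>A. h (f a))"
  by (induction A rule: infinite_finite_induct) (simp_all add: hom_add)

lemma hom_prod: "h (prod f A) = (\<Prod>a\<in>A. h (f a))"
  by (induction A rule: infinite_finite_induct) (simp_all add: hom_mult)

lemma hom_power: "h (a ^ k) = h a ^ k"
  by (induction k) (simp_all add: hom_mult)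

lemma hom_of_nat: "h (of_nat k) = of_nat k"
  by (induction k) (simp_all add: hom_add)

lemma hom_of_int: "h (of_int k) = of_int k"
  by (cases k rule: int_cases2) (simp_all add: hom_of_nat hom_uminus)

end

text \<open>The action of \<open>h\<close> on power series, coefficient by coefficient.\<close>

definition fps_hom :: "('a \<Rightarrow> 'b) \<Rightarrow> 'a fps \<Rightarrow> 'b fps" where
  "fps_hom h P = Abs_fps (\<lambda>n. h (fps_nth P n))"

lemma fps_hom_nth [simp]: "fps_nth (fps_hom h P) n = h (fps_nth P n)"
  by (simp add: fps_hom_def)

lemma (in cring_hom) cring_hom_fps_hom: "cring_hom (fps_hom h)"
  by unfold_locales (auto simp: fps_eq_iff fps_mult_nth hom_add hom_mult hom_sum)

text \<open>
  A power series with constant coefficient 1 is invertible over any commutative ring, so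
  \<open>unit_powi\<close> gives the true integer powers of such a series.
\<close>

lemma unit_inverse_exists:
  fixes P :: "'a::comm_ring_1 fps"
  assumes "fps_nth P 0 = 1"
  shows "P * (THE b. P * b = 1) = 1"
proof -
  have ex: "P * fps_right_inverse P 1 = 1"
    by (rule fps_right_inverse) (simp add: assms)
  have "b = c" if "P * b = 1" "P * c = 1" for b c
    using that by (metis mult.commute mult.left_commute mult_1_right)
  with ex have "\<exists>!b. P * b = 1" by blast
  then show ?thesis by (rule theI')
qed

lemma the_inverse_eqI:
  fixes P :: "'a::comm_ring_1"
  assumes "P * b = 1"
  shows "(THE b. P * b = 1) = b"
  using assms by (intro the_equality) (metis mult.commute mult.left_commute mult_1_right)+

lemma (in cring_hom) fps_hom_unit_powi:
  assumes "fps_nth P 0 = 1"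
  shows "fps_hom h (unit_powi P k) = unit_powi (fps_hom h P) k"
proof -
  interpret F: cring_hom "fps_hom h" by (rule cring_hom_fps_hom)
  have "fps_hom h P * fps_hom h (THE b. P * b = 1) = 1"
    using unit_inverse_exists[OF assms] by (metis F.hom_mult F.hom_one)
  from the_inverse_eqI[OF this] show ?thesis
    by (simp add: unit_powi_def F.hom_power)
qed

text \<open>
  \<open>L\<close> is the logarithmic derivative of \<open>P\<close> with respect to the derivation \<open>T d/dT\<close>.
\<close>

definition has_dlog :: "'a::comm_ring_1 fps \<Rightarrow> 'a fps \<Rightarrow> bool" where
  "has_dlog P L \<longleftrightarrow> fps_nth P 0 = 1 \<and> fps_X * fps_deriv P = P * L"

lemma fps_X_deriv_nth: "fps_nth (fps_X * fps_deriv P) n = of_nat n * fps_nth P n"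
  for P :: "'a::comm_ring_1 fps"
  by (cases n) simp_all

lemma has_dlog_iff:
  "has_dlog P L \<longleftrightarrow> fps_nth P 0 = 1 \<and>
     (\<forall>n. of_nat n * fps_nth P n = (\<Sum>j=0..n. fps_nth P j * fps_nth L (n - j)))"
  unfolding has_dlog_def fps_eq_iff by (simp only: fps_X_deriv_nth fps_mult_nth[of P L])

lemma has_dlog_one: "has_dlog 1 0"
  by (simp add: has_dlog_def)

lemma has_dlog_mult:
  assumes "has_dlog P L" "has_dlog Q M"
  shows "has_dlog (P * Q) (L + M)"
proof -
  have "fps_X * fps_deriv (P * Q) = P * (fps_X * fps_deriv Q) + (fps_X * fps_deriv P) * Q"
    by (simp add: algebra_simps)
  also have "\<dots> = P * Q * (L + M)" using assms by (simp add: has_dlog_def algebra_simps)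
  finally show ?thesis using assms by (simp add: has_dlog_def)
qed

lemma has_dlog_prod:
  "(\<And>a. a \<in> A \<Longrightarrow> has_dlog (P a) (L a)) \<Longrightarrow> has_dlog (\<Prod>a\<in>A. P a) (\<Sum>a\<in>A. L a)"
  by (induction A rule: infinite_finite_induct) (auto intro: has_dlog_one has_dlog_mult)

lemma has_dlog_power: "has_dlog P L \<Longrightarrow> has_dlog (P ^ k) (of_nat k * L)"
  by (induction k) (auto simp: has_dlog_one distrib_right intro: has_dlog_mult)

lemma has_dlog_inverse:
  assumes "has_dlog P L" "P * Q = 1"
  shows "has_dlog Q (- L)"
proof -
  have "fps_X * fps_deriv (P * Q) = 0" using assms(2) by simp
  then have "P * (fps_X * fps_deriv Q) + (fps_X * fps_deriv P) * Q = 0"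
    by (simp add: algebra_simps)
  then have "P * (fps_X * fps_deriv Q) + (P * L) * Q = 0"
    using assms(1) by (simp only: has_dlog_def)
  then have "P * (fps_X * fps_deriv Q) = - (P * Q) * L"
    by (simp add: eq_neg_iff_add_eq_0 mult.commute mult.left_commute)
  then have "(P * Q) * (fps_X * fps_deriv Q) = - (P * Q) * Q * L"
    by (simp only: mult.assoc mult.left_commute[of P Q] minus_mult_left[symmetric] minus_mult_right[symmetric])
  moreover have "fps_nth Q 0 = 1"
    using assms by (metis fps_mult_nth_0 fps_one_nth has_dlog_def mult_1)
  ultimately show ?thesis using assms(2) by (simp add: has_dlog_def)
qed

lemma has_dlog_unit_powi:
  assumes "has_dlog P L"
  shows "has_dlog (unit_powi P k) (of_int k * L)"
proof (cases "k \<ge> 0")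
  case True
  then show ?thesis using has_dlog_power[OF assms, of "nat k"] by (simp add: unit_powi_def)
next
  case False
  have "has_dlog (THE b. P * b = 1) (- L)"
    using assms by (intro has_dlog_inverse[OF assms] unit_inverse_exists) (simp add: has_dlog_def)
  from has_dlog_power[OF this, of "nat (- k)"] show ?thesis
    using False by (simp add: unit_powi_def)
qed

lemma (in cring_hom) has_dlog_hom:
  assumes "has_dlog P L"
  shows "has_dlog (fps_hom h P) (fps_hom h L)"
  unfolding has_dlog_iff
proof (intro conjI allI)
  show "fps_nth (fps_hom h P) 0 = 1" using assms by (simp add: has_dlog_def)
  fix n
  have "h (of_nat n * fps_nth P n) = h (\<Sum>j=0..n. fps_nth P j * fps_nth L (n - j))"
    using assms by (simp only: has_dlog_iff)
  then show "of_nat n * fps_nth (fps_hom h P) n =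
      (\<Sum>j=0..n. fps_nth (fps_hom h P) j * fps_nth (fps_hom h L) (n - j))"
    by (simp add: hom_mult hom_of_nat hom_sum)
qed

text \<open>\<open>T d/dT\<close> applied to \<open>log (1 - c T\<^sup>e) = - \<Sum>\<^sub>k c\<^sup>k T\<^sup>e\<^sup>k / k\<close>.\<close>

lemma has_dlog_one_minus:
  fixes c :: "'a::comm_ring_1"
  assumes "e \<ge> 1"
  shows "has_dlog (1 - fps_const c * fps_X ^ e)
     (- Abs_fps (\<lambda>n. if n > 0 \<and> e dvd n then of_nat e * c ^ (n div e) else 0))"
    (is "has_dlog ?P (- ?G)")
proof -
  have "fps_X * fps_deriv ?P = ?P * (- ?G)"
  proof (rule fps_ext)
    fix n
    have l: "fps_nth (fps_X * fps_deriv ?P) n = (if n = e then - (of_nat e * c) else 0)"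
      using assms by (auto simp: fps_X_deriv_nth)
    have "fps_nth (?P * (- ?G)) n = - fps_nth ?G n + c * fps_nth (fps_X ^ e * ?G) n"
      by (simp add: algebra_simps)
    also have "\<dots> = (if n = e then - (of_nat e * c) else 0)"
    proof (cases "e dvd n")
      case True
      then obtain k where n: "n = e * k" by blast
      show ?thesis
      proof (cases k)
        case (Suc k')
        then show ?thesis using assms n
          by (cases k') (auto simp: fps_X_power_mult_nth algebra_simps)
      qed (use n assms in \<open>auto simp: fps_X_power_mult_nth\<close>)
    next
      case False
      have "fps_nth (fps_X ^ e * ?G) n = 0"
      proof (cases "n < e")
        case ge: False
        then have "\<not> e dvd n - e"
          using False dvd_diffD[of e n e] by auto
        with ge show ?thesis by (simp add: fps_X_power_mult_nth)
      qed (simp add: fps_X_power_mult_nth)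
      moreover have "n \<noteq> e" using False by auto
      ultimately show ?thesis using False by simp
    qed
    finally show "fps_nth (fps_X * fps_deriv ?P) n = fps_nth (?P * (- ?G)) n" using l by simp
  qed
  then show ?thesis using assms by (simp add: has_dlog_def)
qed

text \<open>
  Over a ring without additive torsion, a series with constant coefficient 1 is determined by its
  logarithmic derivative.
\<close>

lemma has_dlog_unique:
  fixes P Q :: "'a::comm_ring_1 fps"
  assumes "has_dlog P L" "has_dlog Q L"
    and tf: "\<And>n (a::'a) b. n > 0 \<Longrightarrow> of_nat n * a = of_nat n * b \<Longrightarrow> a = b"
  shows "P = Q"
proof (rule fps_ext)
  fix n show "fps_nth P n = fps_nth Q n"
  proof (induction n rule: less_induct)
    case (less n)
    have L0: "fps_nth L 0 = 0" using assms(1)[unfolded has_dlog_iff] by (auto dest: spec[of _ 0])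
    have eq: "of_nat n * fps_nth R n = (\<Sum>j<n. fps_nth R j * fps_nth L (n - j))"
      if "has_dlog R L" for R
    proof -
      have "{0..n} = insert n {..<n}" by auto
      then show ?thesis using that L0 by (auto simp: has_dlog_iff)
    qed
    have "of_nat n * fps_nth P n = of_nat n * fps_nth Q n"
      unfolding eq[OF assms(1)] eq[OF assms(2)] by (rule sum.cong) (use less in auto)
    then show ?case
      using tf[of n] assms(1,2) by (cases "n = 0") (auto simp: has_dlog_def)
  qed
qed

section \<open>Homomorphisms between rings of Laurent series\<close>

lemma mlcoeff_sum: "mlcoeff (sum f A) a = (\<Sum>i\<in>A. mlcoeff (f i) a)"
  by (induction A rule: infinite_finite_induct) (simp_all add: zero_mlaurent.rep_eq plus_mlaurent.rep_eq)

lemma mlcoeff_of_nat_mult: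
  fixes f :: "'a::comm_ring_1 mlaurent"
  shows "mlcoeff (of_nat k * f) a = of_nat k * mlcoeff f a"
  by (induction k) (simp_all add: zero_mlaurent.rep_eq plus_mlaurent.rep_eq distrib_right)

lemma mlaurent_torsion_free:
  fixes f g :: "'a::{idom,ring_char_0} mlaurent"
  assumes "n > 0" "of_nat n * f = of_nat n * g"
  shows "f = g"
proof (rule mlaurent_eqI)
  fix m
  have "of_nat n * mlcoeff f m = of_nat n * mlcoeff g m"
    using assms(2) by (metis mlcoeff_of_nat_mult)
  then show "mlcoeff f m = mlcoeff g m" using assms(1) by simp
qed

lemma finite_mlaurent_support: "finite {a. mlcoeff f a \<noteq> 0 \<and> mlcoeff g (m - a) \<noteq> 0}"
proof -
  have "\<exists>N K. laurent_bound N K (mlcoeff f)" "\<exists>N K. laurent_bound N K (mlcoeff g)"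
    using mlcoeff[of f] mlcoeff[of g] by auto
  then obtain N K where "laurent_bound N K (mlcoeff f)" "laurent_bound N K (mlcoeff g)"
    by (rule laurent_bound_common)
  then show ?thesis by (rule finite_laurent_support)
qed

lemma ml_monom_mult:
  "ml_monom (c::'a::comm_ring_1) m * ml_monom c' m' = ml_monom (c * c') (m + m')"
proof (rule mlaurent_eqI)
  fix a
  have "mlcoeff (ml_monom c m * ml_monom c' m') a =
    (\<Sum>b\<in>{m}. mlcoeff (ml_monom c m) b * mlcoeff (ml_monom c' m') (a - b))"
    unfolding times_mlaurent.rep_eq
    by (rule laurent_mult_superset) (auto simp: mlcoeff_ml_monom)
  also have "\<dots> = mlcoeff (ml_monom (c * c') (m + m')) a"
    by (auto simp: mlcoeff_ml_monom algebra_simps)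
  finally show "mlcoeff (ml_monom c m * ml_monom c' m') a = mlcoeff (ml_monom (c * c') (m + m')) a" .
qed

lemma ml_monom_one [simp]: "ml_monom (1::'a::comm_ring_1) 0 = 1"
  by (rule mlaurent_eqI) (simp add: mlcoeff_ml_monom one_mlaurent.rep_eq)

interpretation constant_hom: cring_hom "\<lambda>c::'a::comm_ring_1. ml_monom c 0"
  by unfold_locales
    (auto simp: ml_monom_mult intro!: mlaurent_eqI simp: mlcoeff_ml_monom plus_mlaurent.rep_eq)

interpretation ml_of_int: cring_hom ml_of_int
proof
  show "ml_of_int 1 = 1"
    by (rule mlaurent_eqI) (simp add: ml_of_int.rep_eq one_mlaurent.rep_eq)
  fix f g
  show "ml_of_int (f + g) = ml_of_int f + ml_of_int g"
    by (rule mlaurent_eqI) (simp add: ml_of_int.rep_eq plus_mlaurent.rep_eq)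
  show "ml_of_int (f * g) = ml_of_int f * ml_of_int g"
    by (rule mlaurent_eqI)
      (simp add: ml_of_int.rep_eq times_mlaurent.rep_eq laurent_mult_def flip: of_int_mult)
qed

text \<open>
  For \<open>d \<ge> 1\<close> the exponents of \<open>f(t\<^sup>d)\<close> are the multiples \<open>d m\<close>, and \<open>m\<close> is recovered from \<open>d m\<close>.
\<close>

lift_definition scale_exp :: "nat \<Rightarrow> (nat \<Rightarrow>\<^sub>0 int) \<Rightarrow> (nat \<Rightarrow>\<^sub>0 int)"
  is "\<lambda>d m i. int d * m i"
  by (rule finite_subset) auto

lemma lookup_scale_exp [simp]:
  "Poly_Mapping.lookup (scale_exp d m) i = int d * Poly_Mapping.lookup m i"
  by (simp add: scale_exp.rep_eq)

lemma inj_scale_exp: "d \<ge> 1 \<Longrightarrow> scale_exp d m = scale_exp d m' \<longleftrightarrow> m = m'"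
  by (auto simp: poly_mapping_eq_iff fun_eq_iff)

lemma scale_exp_diff: "scale_exp d a - scale_exp d b = scale_exp d (a - b)"
  by (rule poly_mapping_eqI) (simp add: lookup_minus algebra_simps)

lemma scale_exp_scale_exp: "scale_exp d (scale_exp k m) = scale_exp (d * k) m"
  by (rule poly_mapping_eqI) simp

lemma scale_exp_zero [simp]: "scale_exp d 0 = 0"
  by (rule poly_mapping_eqI) simp

lemma mlcoeff_subst_scale:
  assumes "d \<ge> 1"
  shows "mlcoeff (ml_subst_power d f) (scale_exp d m) = mlcoeff f m"
proof -
  have "Poly_Mapping.map (\<lambda>k. k div int d) (scale_exp d m) = m"
    using assms by (intro poly_mapping_eqI) (simp add: Poly_Mapping.map.rep_eq when_def)
  then show ?thesis by (simp add: ml_subst_power.rep_eq)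
qed

lemma mlcoeff_subst_nonmultiple:
  assumes "a \<notin> range (scale_exp d)"
  shows "mlcoeff (ml_subst_power d f) a = 0"
proof -
  have False if "\<forall>i. int d dvd Poly_Mapping.lookup a i"
  proof -
    have "scale_exp d (Poly_Mapping.map (\<lambda>k. k div int d) a) = a"
      using that by (intro poly_mapping_eqI) (simp add: Poly_Mapping.map.rep_eq when_def)
    then show False using assms by (metis rangeI)
  qed
  then show ?thesis by (auto simp: ml_subst_power.rep_eq)
qed

lemma mlaurent_subst_eqI:
  assumes "\<And>a. a \<notin> range (scale_exp d) \<Longrightarrow> mlcoeff f a = 0"
    and "d \<ge> 1" "\<And>m. mlcoeff f (scale_exp d m) = mlcoeff g m"
  shows "f = ml_subst_power d g"
  by (rule mlaurent_eqI)
    (metis assms mlcoeff_subst_nonmultiple mlcoeff_subst_scale rangeE)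

lemma subst_monom: "d \<ge> 1 \<Longrightarrow> ml_subst_power d (ml_monom c m) = ml_monom c (scale_exp d m)"
  by (rule mlaurent_subst_eqI[symmetric]) (auto simp: mlcoeff_ml_monom inj_scale_exp)

lemma ml_monom_power: "ml_monom (1::'a::comm_ring_1) m ^ k = ml_monom 1 (scale_exp k m)"
proof (induction k)
  case 0
  have "scale_exp 0 m = 0" by (rule poly_mapping_eqI) simp
  then show ?case by simp
next
  case (Suc k)
  have "m + scale_exp k m = scale_exp (Suc k) m"
    by (rule poly_mapping_eqI) (simp add: lookup_add algebra_simps)
  with Suc show ?case by (simp add: ml_monom_mult)
qed

lemma cring_hom_ml_subst_power:
  assumes d: "d \<ge> 1"
  shows "cring_hom (ml_subst_power d :: 'a::comm_ring_1 mlaurent \<Rightarrow> _)"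
proof
  show "ml_subst_power d (1::'a mlaurent) = 1"
    using subst_monom[OF d, of "1::'a" 0] by simp
  fix f g :: "'a mlaurent"
  show "ml_subst_power d (f + g) = ml_subst_power d f + ml_subst_power d g"
    by (rule mlaurent_subst_eqI[symmetric, OF _ d])
      (simp_all add: plus_mlaurent.rep_eq mlcoeff_subst_nonmultiple mlcoeff_subst_scale[OF d])
  show "ml_subst_power d (f * g) = ml_subst_power d f * ml_subst_power d g"
  proof (rule mlaurent_subst_eqI[symmetric, OF _ d])
    fix a :: "nat \<Rightarrow>\<^sub>0 int" assume a: "a \<notin> range (scale_exp d)"
    have "\<not> (mlcoeff (ml_subst_power d f) b \<noteq> 0 \<and> mlcoeff (ml_subst_power d g) (a - b) \<noteq> 0)" for b
    proof
      assume "mlcoeff (ml_subst_power d f) b \<noteq> 0 \<and> mlcoeff (ml_subst_power d g) (a - b) \<noteq> 0"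
      then obtain b' c' where "b = scale_exp d b'" "a - b = scale_exp d c'"
        using mlcoeff_subst_nonmultiple by blast
      then have "a = scale_exp d b' + scale_exp d c'" by (metis add_diff_cancel_left' add.commute diff_add_cancel)
      then have "a = scale_exp d (b' + c')"
        by (intro poly_mapping_eqI) (simp add: lookup_add distrib_left)
      then show False using a by blast
    qed
    then show "mlcoeff (ml_subst_power d f * ml_subst_power d g) a = 0"
      unfolding times_mlaurent.rep_eq laurent_mult_def by (intro sum.neutral) blast
  next
    fix m
    let ?S = "{a. mlcoeff f a \<noteq> 0 \<and> mlcoeff g (m - a) \<noteq> 0}"
    have "mlcoeff (ml_subst_power d f * ml_subst_power d g) (scale_exp d m) =
      (\<Sum>b\<in>scale_exp d ` ?S. mlcoeff (ml_subst_power d f) b * mlcoeff (ml_subst_power d g) (scale_exp d m - b))"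
      unfolding times_mlaurent.rep_eq
    proof (rule laurent_mult_superset)
      show "finite (scale_exp d ` ?S)" by (intro finite_imageI finite_mlaurent_support)
      show "{a. mlcoeff (ml_subst_power d f) a \<noteq> 0 \<and>
          mlcoeff (ml_subst_power d g) (scale_exp d m - a) \<noteq> 0} \<subseteq> scale_exp d ` ?S"
      proof safe
        fix a assume nz: "mlcoeff (ml_subst_power d f) a \<noteq> 0"
          "mlcoeff (ml_subst_power d g) (scale_exp d m - a) \<noteq> 0"
        obtain a' where a': "a = scale_exp d a'"
          using nz(1) mlcoeff_subst_nonmultiple by blast
        with nz show "a \<in> scale_exp d ` ?S"
          by (auto simp: scale_exp_diff mlcoeff_subst_scale[OF d])
      qed
    qed
    also have "\<dots> = (\<Sum>b\<in>?S. mlcoeff f b * mlcoeff g (m - b))"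
      by (subst sum.reindex)
        (auto simp: inj_on_def inj_scale_exp[OF d] scale_exp_diff mlcoeff_subst_scale[OF d])
    also have "\<dots> = mlcoeff (f * g) m" by (simp add: times_mlaurent.rep_eq laurent_mult_def)
    finally show "mlcoeff (ml_subst_power d f * ml_subst_power d g) (scale_exp d m) = mlcoeff (f * g) m" .
  qed
qed

lemma subst_subst:
  assumes "d \<ge> 1" "k \<ge> 1"
  shows "ml_subst_power d (ml_subst_power k f) = ml_subst_power (d * k) f"
proof (rule mlaurent_subst_eqI)
  show "d * k \<ge> 1" using assms by simp
  show "mlcoeff (ml_subst_power d (ml_subst_power k f)) (scale_exp (d * k) m) = mlcoeff f m" for m
    by (metis mlcoeff_subst_scale assms scale_exp_scale_exp)
  fix a assume a: "a \<notin> range (scale_exp (d * k))"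
  show "mlcoeff (ml_subst_power d (ml_subst_power k f)) a = 0"
  proof (cases "a \<in> range (scale_exp d)")
    case True
    then obtain b where b: "a = scale_exp d b" by blast
    have "b \<notin> range (scale_exp k)"
    proof
      assume "b \<in> range (scale_exp k)"
      then obtain c where "b = scale_exp k c" by blast
      then show False using a b by (simp add: scale_exp_scale_exp)
    qed
    then show ?thesis using b by (simp add: mlcoeff_subst_scale[OF assms(1)] mlcoeff_subst_nonmultiple)
  qed (rule mlcoeff_subst_nonmultiple)
qed

text \<open>The substitution \<open>t \<mapsto> t\<^sup>d, T \<mapsto> T\<^sup>d\<close>.\<close>

definition adams :: "nat \<Rightarrow> 'a::comm_ring_1 mlaurent fps \<Rightarrow> 'a mlaurent fps" where
  "adams d P = Abs_fps (\<lambda>n. if d dvd n then ml_subst_power d (fps_nth P (n div d)) else 0)"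

lemma adams_nth:
  "fps_nth (adams d P) n = (if d dvd n then ml_subst_power d (fps_nth P (n div d)) else 0)"
  by (simp add: adams_def)

lemma adams_mult:
  fixes P Q :: "'a::comm_ring_1 mlaurent fps"
  assumes d: "d \<ge> 1"
  shows "adams d (P * Q) = adams d P * adams d Q"
proof (rule fps_ext)
  fix n
  interpret cring_hom "ml_subst_power d :: 'a mlaurent \<Rightarrow> _" by (rule cring_hom_ml_subst_power[OF d])
  have zero: "fps_nth (adams d P) i * fps_nth (adams d Q) (n - i) = 0"
    if "i \<le> n" "\<not> (d dvd n \<and> d dvd i)" for i
    using that by (auto simp: adams_nth) (metis dvd_add le_add_diff_inverse)
  show "fps_nth (adams d (P * Q)) n = fps_nth (adams d P * adams d Q) n"
  proof (cases "d dvd n")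
    case False
    then show ?thesis using zero by (simp add: fps_mult_nth adams_nth[of d "P * Q"])
  next
    case True
    then obtain k where n: "n = d * k" by blast
    have "fps_nth (adams d P * adams d Q) n =
        (\<Sum>i\<in>(\<lambda>j. d * j) ` {0..k}. fps_nth (adams d P) i * fps_nth (adams d Q) (n - i))"
      unfolding fps_mult_nth
    proof (rule sum.mono_neutral_right)
      show "\<forall>i\<in>{0..n} - (*) d ` {0..k}. fps_nth (adams d P) i * fps_nth (adams d Q) (n - i) = 0"
      proof
        fix i assume i: "i \<in> {0..n} - (*) d ` {0..k}"
        have "\<not> d dvd i"
        proof
          assume "d dvd i"
          then obtain j where "i = d * j" by blast
          with i n d show False by auto
        qed
        with i zero[of i] show "fps_nth (adams d P) i * fps_nth (adams d Q) (n - i) = 0" by auto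
      qed
    qed (use n in auto)
    also have "\<dots> = (\<Sum>j=0..k. ml_subst_power d (fps_nth P j) * ml_subst_power d (fps_nth Q (k - j)))"
      by (subst sum.reindex)
        (use d in \<open>auto simp: inj_on_def adams_nth n simp flip: diff_mult_distrib2\<close>)
    also have "\<dots> = fps_nth (adams d (P * Q)) n"
      using d by (simp add: adams_nth n fps_mult_nth hom_sum hom_mult)
    finally show ?thesis by simp
  qed
qed

lemma has_dlog_adams:
  fixes P L :: "'a::comm_ring_1 mlaurent fps"
  assumes d: "d \<ge> 1" and P: "has_dlog P L"
  shows "has_dlog (adams d P) (of_nat d * adams d L)"
proof -
  interpret cring_hom "ml_subst_power d :: 'a mlaurent \<Rightarrow> _" by (rule cring_hom_ml_subst_power[OF d])
  have "fps_X * fps_deriv (adams d P) = of_nat d * adams d (fps_X * fps_deriv P)"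
  proof (rule fps_ext)
    fix n
    have "fps_nth (of_nat d * Q) n = of_nat d * fps_nth Q n" for Q :: "'a mlaurent fps"
      by (metis fps_mult_left_const_nth fps_of_nat)
    then have "fps_nth (of_nat d * adams d (fps_X * fps_deriv P)) n =
        of_nat d * (if d dvd n then of_nat (n div d) * ml_subst_power d (fps_nth P (n div d)) else 0)"
      by (simp only: adams_nth fps_X_deriv_nth hom_mult hom_of_nat)
    also have "\<dots> = of_nat n * fps_nth (adams d P) n"
      by (auto simp: adams_nth mult.assoc[symmetric] simp flip: of_nat_mult)
    finally show "fps_nth (fps_X * fps_deriv (adams d P)) n =
        fps_nth (of_nat d * adams d (fps_X * fps_deriv P)) n"
      by (simp only: fps_X_deriv_nth)
  qed
  also have "\<dots> = adams d P * (of_nat d * adams d L)"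
    using P by (simp only: has_dlog_def adams_mult[OF d] mult.left_commute)
  finally show ?thesis using P by (simp add: has_dlog_def adams_nth)
qed

section \<open>Coefficientwise limits of Laurent series and of polynomials over them\<close>

text \<open>
  Each coefficient of the net \<open>g\<close> is eventually equal to that of \<open>l\<close>, and the exponents that occur
  are eventually bounded below uniformly. The uniform bound is what makes the limit compatible with
  products.
\<close>

definition laurent_conv :: "'j filter \<Rightarrow> nat \<Rightarrow> ('j \<Rightarrow> 'a::comm_ring_1 mlaurent) \<Rightarrow> 'a mlaurent \<Rightarrow> bool" where
  "laurent_conv \<F> N g l \<longleftrightarrow> (\<exists>K. \<forall>\<^sub>F i in \<F>. laurent_bound N K (mlcoeff (g i))) \<and>
     (\<forall>a. \<forall>\<^sub>F i in \<F>. mlcoeff (g i) a = mlcoeff l a)"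

lemma laurent_conv_limit_bound:
  assumes "\<F> \<noteq> bot" "\<forall>\<^sub>F i in \<F>. laurent_bound N K (mlcoeff (g i))"
    "\<And>a. \<forall>\<^sub>F i in \<F>. mlcoeff (g i) a = l a"
  shows "laurent_bound N K l"
  unfolding laurent_bound_def
proof (intro allI impI)
  fix a assume a: "l a \<noteq> 0"
  have "\<forall>\<^sub>F i in \<F>. a \<in> int_vectors N \<and> (\<forall>i. - int K \<le> Poly_Mapping.lookup a i)"
    using assms(2) assms(3)[of a] by eventually_elim (use a in \<open>simp add: laurent_bound_def\<close>)
  then show "a \<in> int_vectors N \<and> (\<forall>i. - int K \<le> Poly_Mapping.lookup a i)"
    using assms(1) by (simp add: eventually_const_iff)
qed

lemma laurent_convE:
  assumes "\<F> \<noteq> bot" "laurent_conv \<F> N g l"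
  obtains K where "\<forall>\<^sub>F i in \<F>. laurent_bound N K (mlcoeff (g i))" "laurent_bound N K (mlcoeff l)"
  using assms laurent_conv_limit_bound unfolding laurent_conv_def by metis

lemma laurent_conv_unique:
  assumes "\<F> \<noteq> bot" "laurent_conv \<F> N g l" "laurent_conv \<F> N g l'"
  shows "l = l'"
proof (rule mlaurent_eqI)
  fix a
  have "\<forall>\<^sub>F i in \<F>. mlcoeff (g i) a = mlcoeff l a" "\<forall>\<^sub>F i in \<F>. mlcoeff (g i) a = mlcoeff l' a"
    using assms by (auto simp: laurent_conv_def)
  then have "\<forall>\<^sub>F i in \<F>. mlcoeff l a = mlcoeff l' a" by eventually_elim simp
  then show "mlcoeff l a = mlcoeff l' a" using assms(1) by (simp add: eventually_const_iff)
qed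

lemma laurent_conv_exists:
  assumes "\<F> \<noteq> bot" "\<forall>\<^sub>F i in \<F>. laurent_bound N K (mlcoeff (g i))"
    "\<And>a. \<exists>c. \<forall>\<^sub>F i in \<F>. mlcoeff (g i) a = c"
  shows "\<exists>l. laurent_conv \<F> N g l"
proof -
  obtain c where c: "\<And>a. \<forall>\<^sub>F i in \<F>. mlcoeff (g i) a = c a" using assms(3) by metis
  have "laurent_bound N K c" by (rule laurent_conv_limit_bound[OF assms(1,2) c])
  then have "mlcoeff (Abs_mlaurent c) = c" by (intro Abs_mlaurent_inverse) blast
  then show ?thesis using c assms(2) unfolding laurent_conv_def by (metis (no_types))
qed

lemma laurent_conv_const:
  assumes "l \<in> laurent_ring N"
  shows "laurent_conv \<F> N (\<lambda>_. l) l"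
proof -
  obtain N' K where b: "laurent_bound N' K (mlcoeff l)" using mlcoeff[of l] by blast
  have "laurent_bound N K (mlcoeff l)"
    using assms laurent_boundD(2)[OF b] by (auto simp: laurent_bound_def laurent_ring_def)
  then show ?thesis unfolding laurent_conv_def by (intro conjI exI[of _ K] allI always_eventually) auto
qed

lemma laurent_conv_zero: "laurent_conv \<F> N (\<lambda>_. 0) 0"
  by (intro laurent_conv_const) (simp add: laurent_ring_def zero_mlaurent.rep_eq)

lemma laurent_conv_one: "laurent_conv \<F> N (\<lambda>_. 1) 1"
  by (intro laurent_conv_const) (auto simp: laurent_ring_def one_mlaurent.rep_eq int_vectors_def)

lemma laurent_conv_add:
  assumes "laurent_conv \<F> N f l" "laurent_conv \<F> N g m"
  shows "laurent_conv \<F> N (\<lambda>i. f i + g i) (l + m)"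
  unfolding laurent_conv_def
proof (intro conjI allI)
  obtain K K' where "\<forall>\<^sub>F i in \<F>. laurent_bound N K (mlcoeff (f i))"
    "\<forall>\<^sub>F i in \<F>. laurent_bound N K' (mlcoeff (g i))"
    using assms by (auto simp: laurent_conv_def)
  then have "\<forall>\<^sub>F i in \<F>. laurent_bound N (max K K') (mlcoeff (f i + g i))"
  proof eventually_elim
    case (elim i)
    show ?case
      using laurent_bound_mono[OF elim(1) order_refl, of "max K K'"]
        laurent_bound_mono[OF elim(2) order_refl, of "max K K'"]
      unfolding laurent_bound_def plus_mlaurent.rep_eq by (metis add_0 max.cobounded1 max.cobounded2)
  qed
  then show "\<exists>K. \<forall>\<^sub>F i in \<F>. laurent_bound N K (mlcoeff (f i + g i))" by blast
  fix a
  have "\<forall>\<^sub>F i in \<F>. mlcoeff (f i) a = mlcoeff l a" "\<forall>\<^sub>F i in \<F>. mlcoeff (g i) a = mlcoeff m a"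
    using assms by (auto simp: laurent_conv_def)
  then show "\<forall>\<^sub>F i in \<F>. mlcoeff (f i + g i) a = mlcoeff (l + m) a"
    by eventually_elim (simp add: plus_mlaurent.rep_eq)
qed

lemma laurent_conv_sum:
  "(\<And>x. x \<in> A \<Longrightarrow> laurent_conv \<F> N (f x) (l x)) \<Longrightarrow>
     laurent_conv \<F> N (\<lambda>i. \<Sum>x\<in>A. f x i) (\<Sum>x\<in>A. l x)"
  by (induction A rule: infinite_finite_induct) (auto intro: laurent_conv_zero laurent_conv_add)

text \<open>
  With a common bound \<open>K\<close>, the set of indices that contribute to a coefficient of a product does not
  depend on the factors.
\<close>

lemma mlcoeff_mult_box:
  assumes "laurent_bound N K (mlcoeff f)" "laurent_bound N K (mlcoeff g)"
  shows "mlcoeff (f * g) m = (\<Sum>a \<in> {a \<in> int_vectors N. \<forall>i. - int K \<le> Poly_Mapping.lookup a i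
          \<and> Poly_Mapping.lookup a i \<le> Poly_Mapping.lookup m i + int K}. mlcoeff f a * mlcoeff g (m - a))"
  unfolding times_mlaurent.rep_eq
proof (rule laurent_mult_superset[OF finite_int_vectors_box], safe)
  fix a i assume nz: "mlcoeff f a \<noteq> 0" "mlcoeff g (m - a) \<noteq> 0"
  show "a \<in> int_vectors N" "- int K \<le> Poly_Mapping.lookup a i"
    using laurent_boundD[OF assms(1) nz(1)] by auto
  show "Poly_Mapping.lookup a i \<le> Poly_Mapping.lookup m i + int K"
    using laurent_boundD(2)[OF assms(2) nz(2), of i] by (simp add: lookup_minus)
qed

lemma laurent_conv_mult:
  assumes nb: "\<F> \<noteq> bot" and f: "laurent_conv \<F> N f l" and g: "laurent_conv \<F> N g m"
  shows "laurent_conv \<F> N (\<lambda>i. f i * g i) (l * m)"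
proof -
  obtain K1 where K1: "\<forall>\<^sub>F i in \<F>. laurent_bound N K1 (mlcoeff (f i))" "laurent_bound N K1 (mlcoeff l)"
    using laurent_convE[OF nb f] .
  obtain K2 where K2: "\<forall>\<^sub>F i in \<F>. laurent_bound N K2 (mlcoeff (g i))" "laurent_bound N K2 (mlcoeff m)"
    using laurent_convE[OF nb g] .
  define K where "K = max K1 K2"
  have lK: "laurent_bound N K (mlcoeff l)" and mK: "laurent_bound N K (mlcoeff m)"
    using K1(2) K2(2) laurent_bound_mono unfolding K_def by (metis max.cobounded1 max.cobounded2 order_refl)+
  have bounds: "\<forall>\<^sub>F i in \<F>. laurent_bound N K (mlcoeff (f i)) \<and> laurent_bound N K (mlcoeff (g i))"
    using K1(1) K2(1)
    by eventually_elim
      (metis K_def laurent_bound_mono max.cobounded1 max.cobounded2 order_refl)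
  show ?thesis
    unfolding laurent_conv_def
  proof (intro conjI allI exI)
    show "\<forall>\<^sub>F i in \<F>. laurent_bound N (2 * K) (mlcoeff (f i * g i))"
      using bounds by eventually_elim (simp add: times_mlaurent.rep_eq laurent_bound_mult)
    fix a :: "nat \<Rightarrow>\<^sub>0 int"
    let ?B = "{b \<in> int_vectors N. \<forall>i. - int K \<le> Poly_Mapping.lookup b i
          \<and> Poly_Mapping.lookup b i \<le> Poly_Mapping.lookup a i + int K}"
    have "\<forall>\<^sub>F i in \<F>. \<forall>b\<in>?B. mlcoeff (f i) b = mlcoeff l b \<and> mlcoeff (g i) (a - b) = mlcoeff m (a - b)"
      by (intro eventually_ball_finite finite_int_vectors_box ballI eventually_conj)
        (use f g in \<open>auto simp: laurent_conv_def\<close>)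
    with bounds show "\<forall>\<^sub>F i in \<F>. mlcoeff (f i * g i) a = mlcoeff (l * m) a"
    proof eventually_elim
      case (elim i)
      then have b: "laurent_bound N K (mlcoeff (f i))" "laurent_bound N K (mlcoeff (g i))" by auto
      show ?case
        unfolding mlcoeff_mult_box[OF lK mK] mlcoeff_mult_box[OF b]
        by (rule sum.cong[OF refl]) (use elim in auto)
    qed
  qed
qed

lemma laurent_conv_subst:
  assumes d: "d \<ge> 1" and g: "laurent_conv \<F> N g l"
  shows "laurent_conv \<F> N (\<lambda>i. ml_subst_power d (g i)) (ml_subst_power d l)"
  unfolding laurent_conv_def
proof (intro conjI allI)
  obtain K where "\<forall>\<^sub>F i in \<F>. laurent_bound N K (mlcoeff (g i))"
    using g by (auto simp: laurent_conv_def)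
  then have "\<forall>\<^sub>F i in \<F>. laurent_bound N (d * K) (mlcoeff (ml_subst_power d (g i)))"
  proof eventually_elim
    case (elim i)
    show ?case
      unfolding laurent_bound_def
    proof (intro allI impI)
      fix a assume a: "mlcoeff (ml_subst_power d (g i)) a \<noteq> 0"
      then obtain b where b: "a = scale_exp d b" using mlcoeff_subst_nonmultiple by blast
      then have "mlcoeff (g i) b \<noteq> 0" using a by (simp add: mlcoeff_subst_scale[OF d])
      from laurent_boundD[OF elim this]
      have "b \<in> int_vectors N" and K: "\<And>j. - int K \<le> Poly_Mapping.lookup b j" by auto
      then have "a \<in> int_vectors N" by (auto simp: b int_vectors_def in_keys_iff subset_iff)
      moreover have "- int (d * K) \<le> Poly_Mapping.lookup a j" for j
        using mult_left_mono[OF K[of j], of "int d"] by (simp add: b)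
      ultimately show "a \<in> int_vectors N \<and> (\<forall>j. - int (d * K) \<le> Poly_Mapping.lookup a j)" by blast
    qed
  qed
  then show "\<exists>K. \<forall>\<^sub>F i in \<F>. laurent_bound N K (mlcoeff (ml_subst_power d (g i)))" by blast
  fix a
  show "\<forall>\<^sub>F i in \<F>. mlcoeff (ml_subst_power d (g i)) a = mlcoeff (ml_subst_power d l) a"
  proof (cases "a \<in> range (scale_exp d)")
    case True
    then obtain b where "a = scale_exp d b" by blast
    then show ?thesis using g by (simp add: mlcoeff_subst_scale[OF d] laurent_conv_def)
  qed (simp add: mlcoeff_subst_nonmultiple)
qed

text \<open>
  Since the integers have no torsion, convergence of \<open>n g\<close> for an \<open>n > 0\<close> implies that of \<open>g\<close>;
  the limit is then divisible by \<open>n\<close>.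
\<close>

lemma laurent_conv_divide:
  fixes g :: "'j \<Rightarrow> int mlaurent"
  assumes nb: "\<F> \<noteq> bot" and n: "n > 0" and g: "laurent_conv \<F> N (\<lambda>i. of_nat n * g i) l"
  shows "\<exists>l'. laurent_conv \<F> N g l'"
proof -
  obtain K where K: "\<forall>\<^sub>F i in \<F>. laurent_bound N K (mlcoeff (of_nat n * g i))"
    using g by (auto simp: laurent_conv_def)
  show ?thesis
  proof (rule laurent_conv_exists[OF nb])
    show "\<forall>\<^sub>F i in \<F>. laurent_bound N K (mlcoeff (g i))"
      using K by eventually_elim (use n in \<open>auto simp: laurent_bound_def mlcoeff_of_nat_mult\<close>)
    fix a
    have "\<forall>\<^sub>F i in \<F>. mlcoeff (of_nat n * g i) a = mlcoeff l a"
      using g by (auto simp: laurent_conv_def)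
    then have "\<forall>\<^sub>F i in \<F>. mlcoeff (g i) a = mlcoeff l a div int n"
    proof eventually_elim
      case (elim i)
      have "int n * mlcoeff (g i) a = mlcoeff l a" using elim by (simp add: mlcoeff_of_nat_mult)
      then show ?case using n by (metis nonzero_mult_div_cancel_left of_nat_0_eq_iff not_gr_zero)
    qed
    then show "\<exists>c. \<forall>\<^sub>F i in \<F>. mlcoeff (g i) a = c" by blast
  qed
qed

text \<open>The corresponding notion for polynomials, with a uniform bound for the degree.\<close>

definition poly_conv ::
  "'j filter \<Rightarrow> nat \<Rightarrow> ('j \<Rightarrow> 'a::comm_ring_1 mlaurent poly) \<Rightarrow> 'a mlaurent poly \<Rightarrow> bool" where
  "poly_conv \<F> N g l \<longleftrightarrow> (\<exists>D. \<forall>\<^sub>F i in \<F>. degree (g i) \<le> D) \<and>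
     (\<forall>k. laurent_conv \<F> N (\<lambda>i. Polynomial.coeff (g i) k) (Polynomial.coeff l k))"

lemma poly_conv_unique:
  assumes "\<F> \<noteq> bot" "poly_conv \<F> N g l" "poly_conv \<F> N g l'"
  shows "l = l'"
  using assms laurent_conv_unique unfolding poly_conv_def by (metis poly_eqI)

lemma poly_conv_cong:
  assumes "\<forall>\<^sub>F i in \<F>. f i = g i" "poly_conv \<F> N f l"
  shows "poly_conv \<F> N g l"
proof -
  obtain D where "\<forall>\<^sub>F i in \<F>. degree (f i) \<le> D" using assms(2) by (auto simp: poly_conv_def)
  with assms(1) have "\<forall>\<^sub>F i in \<F>. degree (g i) \<le> D" by eventually_elim simp
  moreover have "laurent_conv \<F> N (\<lambda>i. Polynomial.coeff (g i) k) (Polynomial.coeff l k)" for k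
    unfolding laurent_conv_def
  proof (intro conjI allI)
    have *: "laurent_conv \<F> N (\<lambda>i. Polynomial.coeff (f i) k) (Polynomial.coeff l k)"
      using assms(2) by (simp add: poly_conv_def)
    then obtain K where "\<forall>\<^sub>F i in \<F>. laurent_bound N K (mlcoeff (Polynomial.coeff (f i) k))"
      by (auto simp: laurent_conv_def)
    with assms(1) have "\<forall>\<^sub>F i in \<F>. laurent_bound N K (mlcoeff (Polynomial.coeff (g i) k))"
      by eventually_elim simp
    then show "\<exists>K. \<forall>\<^sub>F i in \<F>. laurent_bound N K (mlcoeff (Polynomial.coeff (g i) k))" by blast
    fix a
    have "\<forall>\<^sub>F i in \<F>. mlcoeff (Polynomial.coeff (f i) k) a = mlcoeff (Polynomial.coeff l k) a"
      using * by (simp add: laurent_conv_def)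
    with assms(1) show "\<forall>\<^sub>F i in \<F>. mlcoeff (Polynomial.coeff (g i) k) a = mlcoeff (Polynomial.coeff l k) a"
      by eventually_elim simp
  qed
  ultimately show ?thesis by (auto simp: poly_conv_def)
qed

lemma poly_conv_monom:
  assumes "laurent_conv \<F> N g l"
  shows "poly_conv \<F> N (\<lambda>i. Polynomial.monom (g i) k) (Polynomial.monom l k)"
  using assms unfolding poly_conv_def
  by (auto simp: laurent_conv_zero degree_monom_le intro!: exI[of _ k] always_eventually)

lemma poly_conv_zero: "poly_conv \<F> N (\<lambda>_. 0) 0"
  using poly_conv_monom[OF laurent_conv_zero, of \<F> N 0] by simp

lemma poly_conv_one: "poly_conv \<F> N (\<lambda>_. 1) 1"
  using poly_conv_monom[OF laurent_conv_one, of \<F> N 0] by simp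

lemma poly_conv_add:
  assumes "poly_conv \<F> N f l" "poly_conv \<F> N g m"
  shows "poly_conv \<F> N (\<lambda>i. f i + g i) (l + m)"
proof -
  obtain D E where "\<forall>\<^sub>F i in \<F>. degree (f i) \<le> D" "\<forall>\<^sub>F i in \<F>. degree (g i) \<le> E"
    using assms by (auto simp: poly_conv_def)
  then have "\<forall>\<^sub>F i in \<F>. degree (f i + g i) \<le> max D E"
    by eventually_elim (rule degree_add_le; simp)
  then show ?thesis using assms by (auto simp: poly_conv_def intro: laurent_conv_add)
qed

lemma poly_conv_sum:
  "(\<And>x. x \<in> A \<Longrightarrow> poly_conv \<F> N (f x) (l x)) \<Longrightarrow>
     poly_conv \<F> N (\<lambda>i. \<Sum>x\<in>A. f x i) (\<Sum>x\<in>A. l x)"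
  by (induction A rule: infinite_finite_induct) (auto intro: poly_conv_zero poly_conv_add)

lemma poly_conv_of_nat_mult:
  "poly_conv \<F> N f l \<Longrightarrow> poly_conv \<F> N (\<lambda>i. of_nat k * f i) (of_nat k * l)"
  by (induction k) (auto simp: distrib_right intro: poly_conv_zero poly_conv_add)

lemma poly_conv_mult:
  assumes "\<F> \<noteq> bot" "poly_conv \<F> N f l" "poly_conv \<F> N g m"
  shows "poly_conv \<F> N (\<lambda>i. f i * g i) (l * m)"
proof -
  obtain D E where "\<forall>\<^sub>F i in \<F>. degree (f i) \<le> D" "\<forall>\<^sub>F i in \<F>. degree (g i) \<le> E"
    using assms by (auto simp: poly_conv_def)
  then have "\<forall>\<^sub>F i in \<F>. degree (f i * g i) \<le> D + E"
    by eventually_elim (meson add_mono degree_mult_le order_trans)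
  then show ?thesis using assms
    by (auto simp: poly_conv_def coeff_mult intro!: laurent_conv_sum laurent_conv_mult)
qed

lemma coeff_of_nat_mult: "Polynomial.coeff (of_nat n * p) k = of_nat n * Polynomial.coeff p k"
  for p :: "'a::comm_ring_1 poly"
  by (simp add: of_nat_poly)

lemma poly_conv_divide:
  fixes g :: "'j \<Rightarrow> int mlaurent poly"
  assumes nb: "\<F> \<noteq> bot" and n: "n > 0" and g: "poly_conv \<F> N (\<lambda>i. of_nat n * g i) l"
  shows "\<exists>l'. poly_conv \<F> N g l'"
proof -
  obtain D where D: "\<forall>\<^sub>F i in \<F>. degree (of_nat n * g i) \<le> D"
    using g by (auto simp: poly_conv_def)
  have deg: "\<forall>\<^sub>F i in \<F>. degree (g i) \<le> D"
    using D
  proof eventually_elim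
    case (elim i)
    show ?case
    proof (rule degree_le, intro allI impI)
      fix k assume "D < k"
      then have "of_nat n * Polynomial.coeff (g i) k = of_nat n * 0"
        using elim by (simp add: coeff_eq_0 flip: coeff_of_nat_mult)
      then show "Polynomial.coeff (g i) k = 0" by (rule mlaurent_torsion_free[OF n])
    qed
  qed
  have "\<exists>l'. laurent_conv \<F> N (\<lambda>i. Polynomial.coeff (g i) k) l'" for k
    using g by (intro laurent_conv_divide[OF nb n]) (auto simp: poly_conv_def coeff_of_nat_mult)
  then obtain c where c: "\<And>k. laurent_conv \<F> N (\<lambda>i. Polynomial.coeff (g i) k) (c k)" by metis
  have c0: "c k = 0" if "D < k" for k
  proof -
    have "poly_conv \<F> N (\<lambda>i. Polynomial.monom (Polynomial.coeff (g i) k) 0) 0"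
      by (rule poly_conv_cong[OF _ poly_conv_zero])
        (use deg in eventually_elim, use that in \<open>simp add: coeff_eq_0\<close>)
    then have "Polynomial.monom (c k) 0 = 0"
      using poly_conv_unique[OF nb poly_conv_monom[OF c]] by blast
    then show ?thesis by simp
  qed
  have "Polynomial.coeff (Poly (map c [0..<Suc D])) k = c k" for k
    using c0[of k] by (auto simp: coeff_Poly_eq nth_default_def simp del: upt_Suc)
  then show ?thesis using c deg by (metis poly_conv_def)
qed

lemma poly_conv_eval_one:
  fixes g :: "'j \<Rightarrow> 'a::comm_ring_1 mlaurent poly"
  assumes nb: "\<F> \<noteq> bot" and g: "poly_conv \<F> N g l"
  shows "\<forall>\<^sub>F i in \<F>. mlcoeff (poly (g i) 1) a = mlcoeff (poly l 1) a"
proof -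
  obtain D where D: "\<forall>\<^sub>F i in \<F>. degree (g i) \<le> D" using g by (auto simp: poly_conv_def)
  have eval: "poly p 1 = (\<Sum>k\<le>E. Polynomial.coeff p k)" if "degree p \<le> E" for p :: "'a mlaurent poly" and E
  proof -
    have "poly p 1 = (\<Sum>k\<le>degree p. Polynomial.coeff p k)" by (simp add: poly_altdef)
    also have "\<dots> = (\<Sum>k\<le>E. Polynomial.coeff p k)"
      by (rule sum.mono_neutral_left) (use that in \<open>auto simp: coeff_eq_0\<close>)
    finally show ?thesis .
  qed
  define E where "E = max D (degree l)"
  have "laurent_conv \<F> N (\<lambda>i. \<Sum>k\<le>E. Polynomial.coeff (g i) k) (\<Sum>k\<le>E. Polynomial.coeff l k)"
    using g by (intro laurent_conv_sum) (simp add: poly_conv_def)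
  then have "\<forall>\<^sub>F i in \<F>. mlcoeff (\<Sum>k\<le>E. Polynomial.coeff (g i) k) a = mlcoeff (\<Sum>k\<le>E. Polynomial.coeff l k) a"
    by (simp add: laurent_conv_def)
  with D show ?thesis
    by eventually_elim (simp add: E_def eval[of _ "max D (degree l)"])
qed

text \<open>
  If the logarithmic derivatives converge, so do the series: the coefficients of the series are
  computed from those of the logarithmic derivative by the recursion
  \<open>n p\<^sub>n = \<Sum>\<^sub>j p\<^sub>j L\<^sub>n\<^sub>-\<^sub>j\<close>.
\<close>

lemma dlog_limit:
  fixes P M :: "'j \<Rightarrow> int mlaurent poly fps"
  assumes nb: "\<F> \<noteq> bot" and P: "\<forall>\<^sub>F i in \<F>. has_dlog (P i) (M i)"
    and M: "\<And>n. poly_conv \<F> N (\<lambda>i. fps_nth (M i) n) (fps_nth L n)"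
  shows "\<exists>Q. (\<forall>n. poly_conv \<F> N (\<lambda>i. fps_nth (P i) n) (fps_nth Q n)) \<and> has_dlog Q L"
proof -
  have "\<exists>q. poly_conv \<F> N (\<lambda>i. fps_nth (P i) n) q" for n
  proof (induction n rule: less_induct)
    case (less n)
    then obtain q where q: "\<And>j. j < n \<Longrightarrow> poly_conv \<F> N (\<lambda>i. fps_nth (P i) j) (q j)" by metis
    show ?case
    proof (cases "n = 0")
      case True
      have "\<forall>\<^sub>F i in \<F>. 1 = fps_nth (P i) n"
        using P by eventually_elim (simp add: True has_dlog_def)
      from poly_conv_cong[OF this poly_conv_one] show ?thesis by blast
    next
      case False
      have "poly_conv \<F> N (\<lambda>i. \<Sum>j<n. fps_nth (P i) j * fps_nth (M i) (n - j))
          (\<Sum>j<n. q j * fps_nth L (n - j))"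
        by (intro poly_conv_sum poly_conv_mult nb q M) auto
      moreover have "\<forall>\<^sub>F i in \<F>. (\<Sum>j<n. fps_nth (P i) j * fps_nth (M i) (n - j)) =
          of_nat n * fps_nth (P i) n"
        using P
      proof eventually_elim
        case (elim i)
        have "fps_nth (M i) 0 = 0" using elim[unfolded has_dlog_iff] by (auto dest: spec[of _ 0])
        moreover have "{0..n} = insert n {..<n}" by auto
        ultimately show ?case using elim by (auto simp: has_dlog_iff)
      qed
      ultimately have "poly_conv \<F> N (\<lambda>i. of_nat n * fps_nth (P i) n) (\<Sum>j<n. q j * fps_nth L (n - j))"
        by (rule poly_conv_cong[rotated])
      then show ?thesis using False by (intro poly_conv_divide[OF nb]) auto
    qed
  qed
  then obtain q where q: "\<And>n. poly_conv \<F> N (\<lambda>i. fps_nth (P i) n) (q n)" by metis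
  have "has_dlog (Abs_fps q) L"
    unfolding has_dlog_iff
  proof (intro conjI allI)
    have "\<forall>\<^sub>F i in \<F>. 1 = fps_nth (P i) 0"
      using P by eventually_elim (simp add: has_dlog_def)
    from poly_conv_cong[OF this poly_conv_one] show "fps_nth (Abs_fps q) 0 = 1"
      using poly_conv_unique[OF nb q] by simp
    fix n
    have "poly_conv \<F> N (\<lambda>i. \<Sum>j=0..n. fps_nth (P i) j * fps_nth (M i) (n - j))
        (\<Sum>j=0..n. q j * fps_nth L (n - j))"
      by (intro poly_conv_sum poly_conv_mult nb q M)
    moreover have "\<forall>\<^sub>F i in \<F>. (\<Sum>j=0..n. fps_nth (P i) j * fps_nth (M i) (n - j)) =
        of_nat n * fps_nth (P i) n"
      using P by eventually_elim (simp add: has_dlog_iff)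
    ultimately have "poly_conv \<F> N (\<lambda>i. of_nat n * fps_nth (P i) n) (\<Sum>j=0..n. q j * fps_nth L (n - j))"
      by (rule poly_conv_cong[rotated])
    from poly_conv_unique[OF nb poly_conv_of_nat_mult[OF q] this]
    show "of_nat n * fps_nth (Abs_fps q) n = (\<Sum>j=0..n. fps_nth (Abs_fps q) j * fps_nth L (n - j))"
      by simp
  qed
  with q show ?thesis by (intro exI[of _ "Abs_fps q"]) simp
qed

section \<open>The series \<open>Z\<^sub>C(u, t, T)\<close>\<close>

text \<open>
  The logarithmic derivative of the product over \<open>d\<close> and \<open>m\<close> of the powers of \<open>1 - u t\<^sup>m T\<^sup>d\<close> with
  exponents \<open>- v d m\<close>, where \<open>A d\<close> is the Laurent series with coefficients \<open>v d m\<close>: the coefficient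
  of \<open>T\<^sup>n\<close> is the sum of \<open>d u\<^sup>n\<^sup>/\<^sup>d A\<^sub>d(t\<^sup>n\<^sup>/\<^sup>d)\<close> over the divisors \<open>d\<close> of \<open>n\<close>, with value 0 for \<open>n = 0\<close>.
\<close>

definition product_dlog :: "(nat \<Rightarrow> 'a::comm_ring_1 mlaurent) \<Rightarrow> 'a mlaurent poly fps" where
  "product_dlog A = Abs_fps (\<lambda>n. \<Sum>d \<in> {d. d dvd n \<and> 0 < n}.
     of_nat d * Polynomial.monom (ml_subst_power (n div d) (A d)) (n div d))"

abbreviation u_factor :: "(nat \<Rightarrow> (nat \<Rightarrow>\<^sub>0 int) \<Rightarrow> int) \<Rightarrow> nat \<times> (nat \<Rightarrow>\<^sub>0 int) \<Rightarrow> int mlaurent poly fps" where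
  "u_factor v \<equiv> \<lambda>(d, m). unit_powi (1 - fps_const (Polynomial.monom (ml_monom 1 m) 1) * fps_X ^ d) (- v d m)"

lemma finite_divisors: "finite {d. d dvd n \<and> 0 < (n::nat)}"
  by (rule finite_subset[of _ "{..n}"]) (auto dest: dvd_imp_le)

lemma of_int_mult_monom: "of_int z * Polynomial.monom (ml_monom 1 m) k = Polynomial.monom (ml_monom (z::int) m) k"
proof -
  have "(of_int z :: int mlaurent) = ml_monom z 0"
    using constant_hom.hom_of_int[where 'a = int, of z] by simp
  then show ?thesis by (simp add: of_int_poly mult_monom ml_monom_mult smult_monom)
qed

text \<open>
  The logarithmic derivative of the product over a finite set \<open>F\<close> of factors: the sum over the
  exponents \<open>m\<close> is collected into a Laurent polynomial for each \<open>d\<close>.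
\<close>

lemma has_dlog_finite_product:
  assumes F: "finite F" "F \<subseteq> product_index N"
  shows "has_dlog (\<Prod>i\<in>F. u_factor v i)
     (product_dlog (\<lambda>d. \<Sum>m \<in> {m. (d, m) \<in> F}. ml_monom (v d m) m))"
proof -
  let ?G = "\<lambda>d m. Abs_fps (\<lambda>n. if n > 0 \<and> d dvd n
    then of_nat d * Polynomial.monom (ml_monom (1::int) m) 1 ^ (n div d) else 0)"
  let ?L = "\<lambda>(d, m). of_int (- v d m) * (- ?G d m)"
  have "has_dlog (u_factor v i) (?L i)" if "i \<in> F" for i
  proof -
    obtain d m where im: "i = (d, m)" by (cases i)
    with that F(2) have i: "i = (d, m)" "d \<ge> 1" by (auto simp: product_index_def)
    show ?thesis
      unfolding i(1) prod.case by (intro has_dlog_unit_powi has_dlog_one_minus i(2))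
  qed
  then have "has_dlog (\<Prod>i\<in>F. u_factor v i) (\<Sum>i\<in>F. ?L i)" by (rule has_dlog_prod)
  moreover have "(\<Sum>i\<in>F. ?L i) = product_dlog (\<lambda>d. \<Sum>m \<in> {m. (d, m) \<in> F}. ml_monom (v d m) m)"
  proof (rule fps_ext)
    fix n
    show "fps_nth (\<Sum>i\<in>F. ?L i) n =
      fps_nth (product_dlog (\<lambda>d. \<Sum>m \<in> {m. (d, m) \<in> F}. ml_monom (v d m) m)) n"
    proof (cases "n = 0")
      case True
      then show ?thesis by (auto simp: fps_sum_nth product_dlog_def split: prod.splits intro!: sum.neutral)
    next
      case False
      let ?D = "{d. d dvd n \<and> 0 < n}"
      let ?t = "\<lambda>d m. of_nat d * Polynomial.monom (ml_subst_power (n div d) (ml_monom (v d m) m)) (n div d)"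
      have coeff_L: "fps_nth (?L (d, m)) n = (if d dvd n then ?t d m else 0)" if "(d, m) \<in> F" for d m
      proof -
        have "d \<ge> 1" using that F(2) by (auto simp: product_index_def)
        then have k: "n div d \<ge> 1" if "d dvd n" using that False
          by (metis dvd_div_eq_0_iff less_one not_less)
        have "fps_nth (?L (d, m)) n = of_int (v d m) * fps_nth (?G d m) n"
          by (simp add: fps_of_int[symmetric])
        also have "\<dots> = (if d dvd n then of_nat d * (of_int (v d m) * Polynomial.monom (ml_monom 1 m ^ (n div d)) (n div d)) else 0)"
          using False by (simp add: monom_power mult.left_commute)
        also have "\<dots> = (if d dvd n then ?t d m else 0)"
          using k by (simp add: ml_monom_power subst_monom of_int_mult_monom)
        finally show ?thesis .
      qed
      have "fps_nth (\<Sum>i\<in>F. ?L i) n = (\<Sum>i\<in>F. fps_nth (?L i) n)" by (simp only: fps_sum_nth)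
      also have "\<dots> = (\<Sum>(d, m)\<in>F. if d dvd n then ?t d m else 0)"
        by (rule sum.cong[OF refl]) (use coeff_L in auto)
      also have "\<dots> = (\<Sum>(d, m)\<in>Sigma ?D (\<lambda>d. {m. (d, m) \<in> F}). ?t d m)"
        by (rule sum.mono_neutral_cong_right) (use F False in \<open>auto split: if_splits\<close>)
      also have "\<dots> = (\<Sum>d\<in>?D. \<Sum>m\<in>{m. (d, m) \<in> F}. ?t d m)"
      proof (rule sum.Sigma[symmetric, OF finite_divisors], intro ballI)
        fix d show "finite {m. (d, m) \<in> F}"
          by (rule finite_subset[OF _ finite_imageI[OF F(1), of snd]]) force
      qed
      also have "\<dots> = fps_nth (product_dlog (\<lambda>d. \<Sum>m \<in> {m. (d, m) \<in> F}. ml_monom (v d m) m)) n"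
        unfolding product_dlog_def fps_nth_Abs_fps
      proof (rule sum.cong[OF refl])
        fix d assume d: "d \<in> ?D"
        then have "n div d \<ge> 1" by (auto elim!: dvdE)
        then interpret cring_hom "ml_subst_power (n div d) :: int mlaurent \<Rightarrow> _"
          by (rule cring_hom_ml_subst_power)
        show "(\<Sum>m\<in>{m. (d, m) \<in> F}. ?t d m) = of_nat d * Polynomial.monom
          (ml_subst_power (n div d) (\<Sum>m\<in>{m. (d, m) \<in> F}. ml_monom (v d m) m)) (n div d)"
          by (simp add: hom_sum monom_sum sum_distrib_left)
      qed
      finally show ?thesis .
    qed
  qed
  ultimately show ?thesis by simp
qed

lemma laurent_conv_partial_sums:
  assumes d: "d \<ge> 1" and A: "f \<in> laurent_ring N" "\<And>m. m \<in> int_vectors N \<Longrightarrow> mlcoeff f m = v m"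
  shows "laurent_conv (finite_subsets_at_top (product_index N)) N
     (\<lambda>F. \<Sum>m \<in> {m. (d, m) \<in> F}. ml_monom (v m) m) f"
    (is "laurent_conv ?\<F> N ?g f")
proof -
  have coeff: "mlcoeff (?g F) a = (if (d, a) \<in> F then v a else 0)" if "finite F" for F a
  proof -
    have "finite {m. (d, m) \<in> F}"
      by (rule finite_subset[OF _ finite_imageI[OF that, of snd]]) force
    then show ?thesis by (simp add: mlcoeff_sum mlcoeff_ml_monom)
  qed
  obtain N' K where K: "laurent_bound N' K (mlcoeff f)" using mlcoeff[of f] by blast
  show ?thesis
    unfolding laurent_conv_def
  proof (intro conjI exI allI)
    show "\<forall>\<^sub>F F in ?\<F>. laurent_bound N K (mlcoeff (?g F))"
    proof (rule eventually_finite_subsets_at_top_weakI)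
      fix F assume F: "finite F" "F \<subseteq> product_index N"
      show "laurent_bound N K (mlcoeff (?g F))"
        unfolding laurent_bound_def
      proof (intro allI impI)
        fix a assume "mlcoeff (?g F) a \<noteq> 0"
        then have a: "(d, a) \<in> F" "v a \<noteq> 0" by (auto simp: coeff F(1) split: if_splits)
        then have "a \<in> int_vectors N" using F(2) by (auto simp: product_index_def)
        then show "a \<in> int_vectors N \<and> (\<forall>i. - int K \<le> Poly_Mapping.lookup a i)"
          using a(2) A(2) laurent_boundD(2)[OF K] by auto
      qed
    qed
    fix a
    show "\<forall>\<^sub>F F in ?\<F>. mlcoeff (?g F) a = mlcoeff f a"
    proof (cases "a \<in> int_vectors N")
      case True
      then have "(d, a) \<in> product_index N" using d by (simp add: product_index_def)
      then have "\<forall>\<^sub>F F in ?\<F>. finite F \<and> {(d, a)} \<subseteq> F"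
        unfolding eventually_finite_subsets_at_top by (intro exI[of _ "{(d, a)}"]) auto
      then show ?thesis by eventually_elim (simp add: coeff A(2)[OF True])
    next
      case False
      then have "mlcoeff f a = 0" using A(1) by (auto simp: laurent_ring_def)
      moreover have "\<forall>\<^sub>F F in ?\<F>. finite F \<and> (d, a) \<notin> F"
        by (rule eventually_finite_subsets_at_top_weakI) (use False in \<open>auto simp: product_index_def\<close>)
      ultimately show ?thesis by (auto elim!: eventually_mono simp: coeff)
    qed
  qed
qed

text \<open>
  The infinite product defining \<open>Z\<^sub>C(u, t, T)\<close> converges, because the logarithmic derivatives of its
  finite subproducts do. Its value at \<open>u = 1\<close> is \<open>Z\<^sub>C\<close> of a point, because both are the
  coefficientwise limit of the same finite products.
\<close>

lemma coloring_zeta_u_dlog: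
  assumes "product_exponents N C v"
  obtains A where "has_dlog (coloring_zeta_u N v) (product_dlog A)"
    and "has_dlog (coloring_zeta_point C) (fps_hom (\<lambda>p. poly p 1) (product_dlog A))"
proof -
  let ?\<F> = "finite_subsets_at_top (product_index N)"
  have nb: "?\<F> \<noteq> bot" by simp
  have "\<exists>f. f \<in> laurent_ring N \<and> (\<forall>m \<in> int_vectors N. mlcoeff f m = v d m)" if "d \<ge> 1" for d
    using assms that unfolding product_exponents_def by blast
  then obtain A where A: "\<And>d. d \<ge> 1 \<Longrightarrow> A d \<in> laurent_ring N"
    "\<And>d m. d \<ge> 1 \<Longrightarrow> m \<in> int_vectors N \<Longrightarrow> mlcoeff (A d) m = v d m" by metis
  let ?S = "\<lambda>F d. \<Sum>m \<in> {m. (d, m) \<in> F}. ml_monom (v d m) m"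
  have conv: "poly_conv ?\<F> N (\<lambda>F. fps_nth (product_dlog (?S F)) n) (fps_nth (product_dlog A) n)" for n
    unfolding product_dlog_def fps_nth_Abs_fps
  proof (intro poly_conv_sum poly_conv_of_nat_mult poly_conv_monom laurent_conv_subst)
    fix d assume d: "d \<in> {d. d dvd n \<and> 0 < n}"
    then show "n div d \<ge> 1" by (auto elim!: dvdE)
    have d1: "d \<ge> 1" using d by (auto elim!: dvdE)
    show "laurent_conv ?\<F> N (\<lambda>F. ?S F d) (A d)"
      by (rule laurent_conv_partial_sums[OF d1 A(1)[OF d1] A(2)[OF d1]])
  qed
  have "\<forall>\<^sub>F F in ?\<F>. has_dlog (\<Prod>i\<in>F. u_factor v i) (product_dlog (?S F))"
    by (rule eventually_finite_subsets_at_top_weakI) (rule has_dlog_finite_product)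
  from dlog_limit[OF nb this conv] obtain Q where
    Q: "\<And>n. poly_conv ?\<F> N (\<lambda>F. fps_nth (\<Prod>i\<in>F. u_factor v i) n) (fps_nth Q n)"
    and dQ: "has_dlog Q (product_dlog A)" by blast
  have "formal_has_prod coeff_Tut (u_factor v) (product_index N) Q"
    using Q unfolding formal_has_prod_def coeff_Tut_def poly_conv_def laurent_conv_def by auto
  moreover have "P = Q" if "formal_has_prod coeff_Tut (u_factor v) (product_index N) P" for P
  proof (rule fps_ext, rule poly_eqI, rule mlaurent_eqI)
    fix n k a
    have "\<forall>\<^sub>F F in ?\<F>. coeff_Tut (n, k, a) (\<Prod>i\<in>F. u_factor v i) = coeff_Tut (n, k, a) P"
      "\<forall>\<^sub>F F in ?\<F>. coeff_Tut (n, k, a) (\<Prod>i\<in>F. u_factor v i) = coeff_Tut (n, k, a) Q"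
      using that calculation unfolding formal_has_prod_def by blast+
    then have "\<forall>\<^sub>F F in ?\<F>. coeff_Tut (n, k, a) P = coeff_Tut (n, k, a) Q" by eventually_elim simp
    then show "mlcoeff (Polynomial.coeff (fps_nth P n) k) a = mlcoeff (Polynomial.coeff (fps_nth Q n) k) a"
      by (simp add: coeff_Tut_def)
  qed
  ultimately have Zu: "coloring_zeta_u N v = Q"
    unfolding coloring_zeta_u_def by (intro the_equality)
  interpret ev: cring_hom "\<lambda>p :: int mlaurent poly. poly p 1" by unfold_locales auto
  interpret fev: cring_hom "fps_hom (\<lambda>p :: int mlaurent poly. poly p 1)" by (rule ev.cring_hom_fps_hom)
  have "coloring_zeta_point C = fps_hom (\<lambda>p. poly p 1) Q"
  proof (rule fps_ext, rule mlaurent_eqI)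
    fix n a
    let ?f = "\<lambda>(d, m). unit_powi (1 - fps_const (ml_monom 1 m) * fps_X ^ d) (- v d m) :: int mlaurent fps"
    have factor: "?f i = fps_hom (\<lambda>p. poly p 1) (u_factor v i)" if "i \<in> product_index N" for i
    proof -
      obtain d m where im: "i = (d, m)" by (cases i)
      with that have i: "i = (d, m)" "d \<ge> 1" by (auto simp: product_index_def)
      have c: "fps_hom (\<lambda>p. poly p 1) (fps_const p) = fps_const (poly p 1)" for p :: "int mlaurent poly"
        by (rule fps_ext) simp
      have X: "fps_hom (\<lambda>p. poly p 1) fps_X = (fps_X :: int mlaurent fps)"
        by (rule fps_ext) (simp add: fps_X_def)
      have "fps_hom (\<lambda>p. poly p 1) (1 - fps_const (Polynomial.monom (ml_monom (1::int) m) 1) * fps_X ^ d) =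
          1 - fps_const (ml_monom 1 m) * fps_X ^ d"
        by (simp add: fev.hom_diff fev.hom_mult fev.hom_power c X poly_monom)
      then show ?thesis using i(2) by (simp add: i(1) ev.fps_hom_unit_powi)
    qed
    have "\<forall>\<^sub>F F in ?\<F>. mlcoeff (fps_nth (\<Prod>i\<in>F. ?f i) n) a = mlcoeff (fps_nth (coloring_zeta_point C) n) a"
      using assms by (auto simp: product_exponents_def formal_has_prod_def coeff_Tt_def)
    moreover have "\<forall>\<^sub>F F in ?\<F>. (\<Prod>i\<in>F. ?f i) = fps_hom (\<lambda>p. poly p 1) (\<Prod>i\<in>F. u_factor v i)"
    proof (rule eventually_finite_subsets_at_top_weakI)
      fix F assume "F \<subseteq> product_index N"
      then show "(\<Prod>i\<in>F. ?f i) = fps_hom (\<lambda>p. poly p 1) (\<Prod>i\<in>F. u_factor v i)"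
        unfolding fev.hom_prod by (intro prod.cong refl factor) blast
    qed
    moreover have "\<forall>\<^sub>F F in ?\<F>. mlcoeff (poly (fps_nth (\<Prod>i\<in>F. u_factor v i) n) 1) a =
        mlcoeff (poly (fps_nth Q n) 1) a"
      by (rule poly_conv_eval_one[OF nb Q])
    ultimately have "\<forall>\<^sub>F F in ?\<F>. mlcoeff (fps_nth (coloring_zeta_point C) n) a =
        mlcoeff (fps_nth (fps_hom (\<lambda>p. poly p 1) Q) n) a"
      by eventually_elim simp
    then show "mlcoeff (fps_nth (coloring_zeta_point C) n) a =
        mlcoeff (fps_nth (fps_hom (\<lambda>p. poly p 1) Q) n) a" by simp
  qed
  then have "has_dlog (coloring_zeta_point C) (fps_hom (\<lambda>p. poly p 1) (product_dlog A))"
    using ev.has_dlog_hom[OF dQ] by simp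
  with that dQ Zu show ?thesis by blast
qed

section \<open>The Frobenius map on the points of a variety\<close>

lemma finite_field_power_card:
  fixes a :: "'f::{field,finite}"
  shows "a ^ CARD('f) = a"
proof (cases "a = 0")
  case True
  then show ?thesis by (simp add: power_0_left)
next
  case False
  let ?U = "UNIV - {0::'f}"
  \<comment> \<open>Multiplication by \<open>a\<close> permutes the nonzero elements.\<close>
  have "(\<Prod>x\<in>?U. x) = (\<Prod>x\<in>?U. a * x)"
    by (rule prod.reindex_bij_witness[of _ "\<lambda>x. a * x" "\<lambda>x. x / a"]) (use False in auto)
  also have "\<dots> = a ^ card ?U * (\<Prod>x\<in>?U. x)" by (simp add: prod.distrib)
  finally have "a ^ card ?U = 1" by simp
  moreover have "CARD('f) = Suc (card ?U)" by (rule card.remove) auto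
  ultimately show ?thesis by (simp only: power_Suc mult_1_right)
qed

lemma card_field_ge_2: "CARD('f::{field,finite}) \<ge> 2"
proof -
  have "card {0, 1::'f} \<le> CARD('f)" by (rule card_mono) auto
  then show ?thesis by simp
qed

text \<open>
  For fixed \<open>y\<close> the polynomial \<open>(X + y)\<^sup>q - X\<^sup>q - y\<^sup>q\<close> has degree below \<open>q\<close>. It vanishes at all
  \<open>q\<close> elements of the finite field, first for \<open>y\<close> in the finite field and then for every \<open>y\<close>.
\<close>

lemma alg_closure_power_card_add:
  fixes x y :: "'f::{field,finite} alg_closure"
  shows "(x + y) ^ CARD('f) = x ^ CARD('f) + y ^ CARD('f)"
proof -
  define q where "q = CARD('f)"
  have q2: "q \<ge> 2" unfolding q_def by (rule card_field_ge_2)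
  define P :: "'f alg_closure \<Rightarrow> 'f alg_closure poly"
    where "P y = (\<Sum>k\<in>{1..<q}. Polynomial.monom (of_nat (q choose k) * y ^ (q - k)) k)" for y
  have eval: "poly (P y) x = (x + y) ^ q - x ^ q - y ^ q" for x y
  proof -
    have "{..q} = insert 0 (insert q {1..<q})" using q2 by auto
    then have "(x + y) ^ q = y ^ q + (x ^ q + (\<Sum>k\<in>{1..<q}. of_nat (q choose k) * x ^ k * y ^ (q - k)))"
      unfolding binomial_ring using q2 by simp
    then show ?thesis by (simp add: P_def poly_sum poly_monom mult_ac)
  qed
  have zero: "P y = 0" if "\<And>a::'f. poly (P y) (to_ac a) = 0" for y
  proof (rule ccontr)
    assume nz: "P y \<noteq> 0"
    have "degree (P y) \<le> q - 1"
      unfolding P_def by (rule degree_sum_le) (auto intro: order_trans[OF degree_monom_le])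
    moreover have "card (range (to_ac :: 'f \<Rightarrow> _)) \<le> card {x. poly (P y) x = 0}"
      by (rule card_mono) (use that poly_roots_finite[OF nz] in auto)
    moreover have "card (range (to_ac :: 'f \<Rightarrow> _)) = q"
      by (simp add: card_image inj_to_ac q_def)
    moreover have "card {x. poly (P y) x = 0} \<le> degree (P y)"
      using nz by (rule card_poly_roots_bound)
    ultimately show False using q2 by linarith
  qed
  \<comment> \<open>First \<open>y\<close> in the finite field; by symmetry this gives the zeros needed for an arbitrary \<open>y\<close>.\<close>
  have "P (to_ac b) = 0" for b :: 'f
    by (rule zero) (simp add: eval q_def finite_field_power_card flip: to_ac_add to_ac_power to_ac_diff)
  then have "(to_ac b + y) ^ q = to_ac b ^ q + y ^ q" for b :: 'f and y
    using eval[of "to_ac b" y] by (simp add: add.commute diff_diff_eq)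
  then have "P y = 0" by (intro zero) (simp add: eval)
  then show ?thesis using eval[of y x] by (simp add: q_def diff_diff_eq)
qed

lemma alg_closure_power_card_sum:
  "sum f A ^ CARD('f) = (\<Sum>a\<in>A. f a ^ CARD('f))"
  for f :: "'b \<Rightarrow> 'f::{field,finite} alg_closure"
  by (induction A rule: infinite_finite_induct) (simp_all add: alg_closure_power_card_add power_0_left)

lemma alg_closure_power_card_inject:
  fixes x y :: "'f::{field,finite} alg_closure"
  shows "x ^ CARD('f) = y ^ CARD('f) \<longleftrightarrow> x = y"
  using alg_closure_power_card_add[of "x - y" y] by auto

lemma mpeval_frobenius:
  fixes p :: "'f::{field,finite} mpolynomial"
  shows "mpeval p (\<lambda>i. x i ^ CARD('f)) = mpeval p x ^ CARD('f)"
  unfolding mpeval_def alg_closure_power_card_sum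
  by (rule sum.cong)
    (simp_all add: power_mult_distrib finite_field_power_card prod_power_distrib
      mult.commute flip: to_ac_power power_mult)

lemma zariski_closed_frobenius:
  fixes Z :: "(nat \<Rightarrow> 'f::{field,finite} alg_closure) set"
  assumes "zariski_closed n Z"
  shows "(\<lambda>i. x i ^ CARD('f)) \<in> Z \<longleftrightarrow> x \<in> Z"
proof -
  obtain S :: "'f mpolynomial set" where "Z = {x \<in> affine_space n. \<forall>p\<in>S. mpeval p x = 0}"
    using assms by (auto simp: zariski_closed_def)
  then show ?thesis by (auto simp: affine_space_def mpeval_frobenius)
qed

context
  fixes V :: "('f::{field,finite}, 'p) chart set"
  assumes V: "variety V"
begin

lemma chart_coord_eqI:
  assumes "c \<in> V" "x \<in> chart_dom c" "y \<in> chart_dom c" "\<And>i. chart_coord c x i = chart_coord c y i"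
  shows "x = y"
proof -
  have "inj_on (chart_coord c) (chart_dom c)" using V assms(1) by (auto simp: variety_def affine_chart_def)
  then show ?thesis using assms(2-4) by (auto dest: inj_onD)
qed

lemma chart_coord_beyond_dim:
  assumes "c \<in> V" "x \<in> chart_dom c" "i \<ge> chart_dim c"
  shows "chart_coord c x i = 0"
proof -
  have "zariski_closed (chart_dim c) (chart_coord c ` chart_dom c)"
    using V assms(1) by (auto simp: variety_def affine_chart_def)
  then have "chart_coord c x \<in> affine_space (chart_dim c)"
    using assms(2) by (auto simp: zariski_closed_def)
  then show ?thesis using assms(3) by (auto simp: affine_space_def)
qed

lemma chart_frobenius_exists:
  assumes "c \<in> V" "x \<in> chart_dom c"
  obtains y where "y \<in> chart_dom c" "\<And>i. chart_coord c y i = chart_coord c x i ^ CARD('f)"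
proof -
  have "zariski_closed (chart_dim c) (chart_coord c ` chart_dom c)"
    using V assms(1) by (auto simp: variety_def affine_chart_def)
  from zariski_closed_frobenius[OF this, of "chart_coord c x"] assms(2)
  have "(\<lambda>i. chart_coord c x i ^ CARD('f)) \<in> chart_coord c ` chart_dom c" by blast
  then obtain y where "y \<in> chart_dom c" "(\<lambda>i. chart_coord c x i ^ CARD('f)) = chart_coord c y" by blast
  then show ?thesis using that by metis
qed

text \<open>The overlap of two charts is the complement of a closed set defined over the finite field.\<close>

lemma overlap_frobenius:
  assumes "c \<in> V" "c' \<in> V" "x \<in> chart_dom c" "y \<in> chart_dom c"
    and "\<And>i. chart_coord c y i = chart_coord c x i ^ CARD('f)"
  shows "y \<in> chart_dom c' \<longleftrightarrow> x \<in> chart_dom c'"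
proof -
  obtain Z where Z: "zariski_closed (chart_dim c) Z"
    "chart_coord c ` (chart_dom c \<inter> chart_dom c') = chart_coord c ` chart_dom c - Z"
    using V assms(1,2) unfolding variety_def open_overlap_def by meson
  have "z \<in> chart_dom c' \<longleftrightarrow> chart_coord c z \<notin> Z" if z: "z \<in> chart_dom c" for z
  proof
    assume "chart_coord c z \<notin> Z"
    then have "chart_coord c z \<in> chart_coord c ` (chart_dom c \<inter> chart_dom c')" using Z(2) z by auto
    then obtain z' where "z' \<in> chart_dom c \<inter> chart_dom c'" "chart_coord c z = chart_coord c z'" by blast
    then show "z \<in> chart_dom c'" using chart_coord_eqI[OF assms(1) z, of z'] by auto
  qed (use Z(2) z in auto)
  moreover have "chart_coord c y = (\<lambda>i. chart_coord c x i ^ CARD('f))" using assms(5) by auto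
  ultimately show ?thesis using assms(3,4) zariski_closed_frobenius[OF Z(1)] by metis
qed

text \<open>Coordinate changes are defined over the finite field, so they commute with Frobenius.\<close>

lemma transition_frobenius:
  assumes "c \<in> V" "c' \<in> V" "x \<in> chart_dom c" "x \<in> chart_dom c'" "y \<in> chart_dom c"
    and y: "\<And>i. chart_coord c y i = chart_coord c x i ^ CARD('f)"
  shows "chart_coord c' y j = chart_coord c' x j ^ CARD('f)"
proof -
  have y': "y \<in> chart_dom c'" using overlap_frobenius[OF assms(1-3,5) y] assms(4) by blast
  show ?thesis
  proof (cases "j < chart_dim c'")
    case True
    have "regular_transition c c'" using V assms(1,2) by (auto simp: variety_def)
    then obtain g h :: "'f mpolynomial" where h: "mpeval h (chart_coord c x) \<noteq> 0"
      and quot: "\<And>y. y \<in> chart_dom c \<inter> chart_dom c' \<Longrightarrow> mpeval h (chart_coord c y) \<noteq> 0 \<Longrightarrow>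
           chart_coord c' y j = mpeval g (chart_coord c y) / mpeval h (chart_coord c y)"
      unfolding regular_transition_def using True assms(3,4) by (metis IntI)
    have cy: "chart_coord c y = (\<lambda>i. chart_coord c x i ^ CARD('f))" using y by auto
    have "mpeval h (chart_coord c y) \<noteq> 0" using h by (simp add: cy mpeval_frobenius)
    then have "chart_coord c' y j = mpeval g (chart_coord c y) / mpeval h (chart_coord c y)"
      using quot[of y] assms(5) y' by blast
    also have "\<dots> = (mpeval g (chart_coord c x) / mpeval h (chart_coord c x)) ^ CARD('f)"
      by (simp add: cy mpeval_frobenius power_divide)
    also have "\<dots> = chart_coord c' x j ^ CARD('f)" using quot[of x] assms(3,4) h by simp
    finally show ?thesis .
  next
    case False
    then show ?thesis
      using chart_coord_beyond_dim[OF assms(2) y'] chart_coord_beyond_dim[OF assms(2,4)]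
      by (simp add: power_0_left)
  qed
qed

lemma frob_coord:
  assumes "c \<in> V" "x \<in> chart_dom c"
  shows "frob V x \<in> chart_dom c" "chart_coord c (frob V x) i = chart_coord c x i ^ CARD('f)"
proof -
  obtain y where y: "y \<in> chart_dom c" "\<And>i. chart_coord c y i = chart_coord c x i ^ CARD('f)"
    using chart_frobenius_exists[OF assms] by blast
  have "frob V x = y"
    unfolding frob_def
  proof (rule the_equality)
    show "\<exists>c\<in>V. x \<in> chart_dom c \<and> y \<in> chart_dom c \<and> (\<forall>i. chart_coord c y i = chart_coord c x i ^ CARD('f))"
      using assms y by blast
    fix z assume "\<exists>c\<in>V. x \<in> chart_dom c \<and> z \<in> chart_dom c \<and> (\<forall>i. chart_coord c z i = chart_coord c x i ^ CARD('f))"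
    then obtain c' where c': "c' \<in> V" "x \<in> chart_dom c'" "z \<in> chart_dom c'"
      "\<And>i. chart_coord c' z i = chart_coord c' x i ^ CARD('f)" by blast
    have "z \<in> chart_dom c" using overlap_frobenius[OF c'(1) assms(1) c'(2-4)] assms(2) by blast
    moreover have "chart_coord c z i = chart_coord c x i ^ CARD('f)" for i
      by (rule transition_frobenius[OF c'(1) assms(1) c'(2) assms(2) c'(3,4)])
    ultimately show "z = y" using chart_coord_eqI[OF assms(1) _ y(1)] y(2) by simp
  qed
  then show "frob V x \<in> chart_dom c" "chart_coord c (frob V x) i = chart_coord c x i ^ CARD('f)"
    using y by auto
qed

lemma frob_in_points: "x \<in> points V \<Longrightarrow> frob V x \<in> points V"
  using frob_coord(1) by (auto simp: points_def)

lemma inj_on_frob: "inj_on (frob V) (points V)"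
proof (rule inj_onI)
  fix x y assume "x \<in> points V" "y \<in> points V" and eq: "frob V x = frob V y"
  then obtain c c' where c: "c \<in> V" "x \<in> chart_dom c" "c' \<in> V" "y \<in> chart_dom c'"
    by (auto simp: points_def)
  have "frob V x \<in> chart_dom c'" using frob_coord(1)[OF c(3,4)] eq by simp
  then have x': "x \<in> chart_dom c'"
    using overlap_frobenius[OF c(1,3,2) frob_coord[OF c(1,2)]] by blast
  show "x = y"
  proof (rule chart_coord_eqI[OF c(3) x' c(4)])
    fix i
    have "chart_coord c' x i ^ CARD('f) = chart_coord c' y i ^ CARD('f)"
      using frob_coord(2)[OF c(3) x', of i] frob_coord(2)[OF c(3,4), of i] eq by simp
    then show "chart_coord c' x i = chart_coord c' y i" by (simp add: alg_closure_power_card_inject)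
  qed
qed

lemma frob_funpow_coord:
  assumes "c \<in> V" "x \<in> chart_dom c"
  shows "(frob V ^^ r) x \<in> chart_dom c \<and>
    (\<forall>i. chart_coord c ((frob V ^^ r) x) i = chart_coord c x i ^ (CARD('f) ^ r))"
  by (induction r) (auto simp: assms frob_coord mult.commute simp flip: power_mult)

lemma rational_points_eq: "rational_points V r = {x \<in> points V. (frob V ^^ r) x = x}"
proof -
  have "(\<forall>i. chart_coord c x i ^ (CARD('f) ^ r) = chart_coord c x i) \<longleftrightarrow> (frob V ^^ r) x = x"
    if "c \<in> V" "x \<in> chart_dom c" for c x
    using frob_funpow_coord[OF that, of r] chart_coord_eqI[OF that(1) _ that(2)] by metis
  then show ?thesis by (auto simp: rational_points_def points_def)
qed

text \<open>The coordinates of a rational point are roots of \<open>X\<^bsup>q^r\<^esup> - X\<close>.\<close>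

lemma finite_rational_points:
  assumes "r \<ge> 1"
  shows "finite (rational_points V r)"
proof -
  let ?K = "{a :: 'f alg_closure. a ^ (CARD('f) ^ r) = a}"
  have q: "CARD('f) ^ r \<ge> 2"
    using power_increasing[of 1 r "CARD('f)"] assms card_field_ge_2[where 'f = 'f] by simp
  have "finite ?K"
  proof -
    let ?p = "Polynomial.monom 1 (CARD('f) ^ r) - Polynomial.monom 1 1 :: 'f alg_closure poly"
    have "Polynomial.coeff ?p (CARD('f) ^ r) = 1" using q by simp
    then have "?p \<noteq> 0" by (metis coeff_0 zero_neq_one)
    then have "finite {a. poly ?p a = 0}" by (rule poly_roots_finite)
    then show ?thesis by (simp add: poly_monom)
  qed
  let ?D = "\<lambda>c. {x \<in> chart_dom c. \<forall>i. chart_coord c x i ^ (CARD('f) ^ r) = chart_coord c x i}"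
  have "finite (?D c)" if c: "c \<in> V" for c
  proof (rule inj_on_finite)
    let ?g = "\<lambda>x. restrict (chart_coord c x) {..<chart_dim c}"
    show "inj_on ?g (?D c)"
    proof (rule inj_onI, rule chart_coord_eqI[OF c])
      fix x y i assume xy: "x \<in> ?D c" "y \<in> ?D c" and eq: "?g x = ?g y"
      show "chart_coord c x i = chart_coord c y i"
      proof (cases "i < chart_dim c")
        case True
        then show ?thesis using fun_cong[OF eq, of i] by simp
      next
        case False
        then show ?thesis
          using chart_coord_beyond_dim[OF c, of x i] chart_coord_beyond_dim[OF c, of y i] xy by simp
      qed
    qed auto
    show "?g ` ?D c \<subseteq> PiE {..<chart_dim c} (\<lambda>_. ?K)"
      by (intro image_subsetI restrict_PiE_iff[THEN iffD2]) auto
    show "finite (PiE {..<chart_dim c} (\<lambda>_. ?K))" using \<open>finite ?K\<close> by (intro finite_PiE) auto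
  qed
  moreover have "rational_points V r = (\<Union>c\<in>V. ?D c)" by (auto simp: rational_points_def)
  moreover have "finite V" using V by (simp add: variety_def)
  ultimately show ?thesis by auto
qed

end

section \<open>Closed points and their degrees\<close>

lemma self_in_orbit_of_step:
  assumes f: "inj_on f P" "f ` P \<subseteq> P" "x \<in> P" and step: "f x \<in> orbit f (f x)"
  shows "x \<in> orbit f x"
proof -
  obtain n where n: "n > 0" "(f ^^ n) (f x) = f x" using step by (auto simp: orbit_altdef)
  have "(f ^^ n) x \<in> P" using f by (induction n) auto
  moreover have "f ((f ^^ n) x) = f x" using n(2) by (metis funpow_swap1)
  ultimately have "(f ^^ n) x = x" using f by (auto dest: inj_onD)
  then show ?thesis
    unfolding orbit_altdef by (intro CollectI exI[of _ n]) (use n(1) in simp)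
qed

lemma cyclic_on_period:
  assumes "cyclic_on f S" "x \<in> S"
  shows "(f ^^ r) x = x \<longleftrightarrow> card S dvd r"
proof -
  have S: "S = orbit f x" using orbit_cyclic_eq3[OF assms] by simp
  then have x: "x \<in> orbit f x" using assms(2) by simp
  let ?d = "funpow_dist1 f x x"
  have card: "card S = ?d"
    unfolding S orbit_conv_funpow_dist1[OF x] by (subst card_image[OF inj_on_funpow_dist1[OF x]]) simp
  have d: "(f ^^ ?d) x = x" by (rule funpow_dist1_prop[OF x])
  have "(f ^^ r) x = (f ^^ (r mod ?d)) x" by (rule funpow_mod_eq[OF d, symmetric])
  moreover have "(f ^^ (r mod ?d)) x = x \<longleftrightarrow> r mod ?d = 0"
    using funpow_dist1_least[of "r mod ?d" f x x] by auto
  ultimately show ?thesis unfolding card by (auto simp: dvd_eq_mod_eq_0)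
qed

lemma self_in_orbit_of_finite:
  assumes S: "finite S" "f ` S \<subseteq> S" "inj_on f S" "x \<in> S"
  shows "x \<in> orbit f x"
proof -
  have mem: "(f ^^ n) x \<in> S" for n using S(2,4) by (induction n) auto
  have "\<not> inj (\<lambda>n. (f ^^ n) x)"
  proof
    assume "inj (\<lambda>n. (f ^^ n) x)"
    then have "infinite (range (\<lambda>n. (f ^^ n) x))" by (rule range_inj_infinite)
    then show False using mem S(1) by (meson finite_subset image_subsetI)
  qed
  then obtain i j where "i \<noteq> j" "(f ^^ i) x = (f ^^ j) x" unfolding inj_def by blast
  then obtain i j where "i < j" "(f ^^ i) x = (f ^^ j) x" by (metis linorder_neqE_nat)
  then obtain i k where ik: "(f ^^ i) x = (f ^^ (i + Suc k)) x"
    using less_imp_Suc_add by (metis add_Suc_right)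
  \<comment> \<open>The first \<open>i\<close> steps cancel because \<open>f\<close> is injective on \<open>S\<close>.\<close>
  have "(f ^^ i) x = (f ^^ (i + Suc k)) x \<Longrightarrow> x = (f ^^ Suc k) x" for i
  proof (induction i)
    case (Suc i)
    have "f ((f ^^ i) x) = f ((f ^^ (i + Suc k)) x)" using Suc.prems by simp
    then show ?case using inj_onD[OF S(3)] mem Suc.IH by blast
  qed simp
  from this[OF ik] show ?thesis unfolding orbit_altdef by force
qed

text \<open>
  The closed points of degree at most \<open>M\<close>: a closed point is a periodic orbit of the Frobenius map,
  and its degree is the size of the orbit.
\<close>

definition closed_points :: "('f::{field,finite}, 'p) chart set \<Rightarrow> nat \<Rightarrow> 'p set set" where
  "closed_points V M = {orb. cyclic_on (frob V) orb \<and> orb \<subseteq> points V \<and> card orb \<le> M}"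

lemma closed_points_card_ge_1: "orb \<in> closed_points V M \<Longrightarrow> card orb \<ge> 1"
  using finite_cyclic_on[of "frob V" orb]
  by (auto simp: closed_points_def cyclic_on_alldef Suc_le_eq card_gt_0_iff)

context
  fixes V :: "('f::{field,finite}, 'p) chart set"
  assumes V: "variety V"
begin

lemma finite_closed_points: "finite (closed_points V M)"
proof -
  have "orb \<in> orbit (frob V) ` (\<Union>r\<in>{1..M}. rational_points V r)" if orb: "orb \<in> closed_points V M" for orb
  proof -
    have c: "cyclic_on (frob V) orb" using orb by (simp add: closed_points_def)
    then obtain x where x: "x \<in> orb" by (auto simp: cyclic_on_def)
    have "x \<in> rational_points V (card orb)"
      using cyclic_on_period[OF c x] x orb by (auto simp: rational_points_eq[OF V] closed_points_def)
    moreover have "orb = orbit (frob V) x" using orbit_cyclic_eq3[OF c x] by simp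
    moreover have "card orb \<in> {1..M}"
      using closed_points_card_ge_1[OF orb] orb by (simp add: closed_points_def)
    ultimately show ?thesis by blast
  qed
  then have "closed_points V M \<subseteq> orbit (frob V) ` (\<Union>r\<in>{1..M}. rational_points V r)" by blast
  then show ?thesis
    by (rule finite_subset) (use finite_rational_points[OF V] in auto)
qed

text \<open>
  The points over the extension of degree \<open>r\<close> make up the closed points whose degree divides \<open>r\<close>. The
  bound \<open>M\<close> only keeps the sum finite.
\<close>

lemma card_rational_points:
  assumes "1 \<le> r" "r \<le> M"
  shows "card (rational_points V r) = (\<Sum>orb\<in>closed_points V M. if card orb dvd r then card orb else 0)"
proof -
  let ?O = "{orb \<in> closed_points V M. card orb dvd r}"
  have "rational_points V r = \<Union>?O"
  proof (intro equalityI subsetI)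
    fix x assume "x \<in> rational_points V r"
    then have x: "x \<in> points V" "(frob V ^^ r) x = x" by (auto simp: rational_points_eq[OF V])
    have self: "x \<in> orbit (frob V) x"
      unfolding orbit_altdef by (intro CollectI exI[of _ r]) (use x(2) assms(1) in simp)
    then have c: "cyclic_on (frob V) (orbit (frob V) x)" by (auto simp: cyclic_on_def)
    have "card (orbit (frob V) x) dvd r" using cyclic_on_period[OF c self] x(2) by simp
    moreover from this have "card (orbit (frob V) x) \<le> M" using assms by (auto dest: dvd_imp_le)
    moreover have "y \<in> points V" if "y \<in> orbit (frob V) x" for y
      using that by induction (auto intro: frob_in_points[OF V] x(1))
    ultimately show "x \<in> \<Union>?O" using c self by (auto simp: closed_points_def subset_iff)
  next
    fix x assume "x \<in> \<Union>?O"
    then obtain orb where orb: "cyclic_on (frob V) orb" "orb \<subseteq> points V" "card orb dvd r" "x \<in> orb"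
      by (auto simp: closed_points_def)
    then show "x \<in> rational_points V r"
      using cyclic_on_period[OF orb(1,4), of r] by (auto simp: rational_points_eq[OF V])
  qed
  also have "card (\<Union>?O) = (\<Sum>orb\<in>?O. card orb)"
    by (rule card_Union_disjoint)
      (auto simp: pairwise_def disjnt_def closed_points_def finite_cyclic_on dest: orbit_cyclic_eq3)
  also have "\<dots> = (\<Sum>orb\<in>closed_points V M. if card orb dvd r then card orb else 0)"
    by (rule sum.inter_filter[OF finite_closed_points])
  finally show ?thesis .
qed

end

section \<open>The coloring zeta function as a product over closed points\<close>

text \<open>
  Expansion of a finite product of sums over the set \<open>S\<close>, graded by the degree functions \<open>w i\<close>.
\<close>

lemma fps_nth_prod_PiE:
  fixes h :: "'i \<Rightarrow> 'c \<Rightarrow> 'a::comm_ring_1" and w :: "'i \<Rightarrow> 'c \<Rightarrow> nat"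
  assumes "finite A" and fin: "\<And>i n. i \<in> A \<Longrightarrow> finite {c \<in> S. w i c = n}"
  shows "fps_nth (\<Prod>i\<in>A. Abs_fps (\<lambda>n. \<Sum>c\<in>{c \<in> S. w i c = n}. h i c)) n =
     (\<Sum>\<phi>\<in>{\<phi> \<in> A \<rightarrow>\<^sub>E S. (\<Sum>i\<in>A. w i (\<phi> i)) = n}. \<Prod>i\<in>A. h i (\<phi> i))"
  using assms
proof (induction A arbitrary: n rule: finite_induct)
  case empty
  then show ?case by (cases "n = 0") auto
next
  case (insert a A)
  let ?C = "\<lambda>k. {c \<in> S. w a c = k}"
  let ?\<Phi> = "\<lambda>k. {\<phi> \<in> A \<rightarrow>\<^sub>E S. (\<Sum>i\<in>A. w i (\<phi> i)) = k}"
  have fin\<Phi>: "finite (?\<Phi> k)" for k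
  proof (rule finite_subset)
    show "?\<Phi> k \<subseteq> (\<Pi>\<^sub>E i\<in>A. \<Union>m\<le>k. {c \<in> S. w i c = m})"
    proof
      fix \<phi> assume \<phi>: "\<phi> \<in> ?\<Phi> k"
      then have "w i (\<phi> i) \<le> k" if "i \<in> A" for i
        using member_le_sum[of i A "\<lambda>i. w i (\<phi> i)"] that insert.hyps(1) by auto
      then show "\<phi> \<in> (\<Pi>\<^sub>E i\<in>A. \<Union>m\<le>k. {c \<in> S. w i c = m})" using \<phi> by (auto simp: PiE_iff)
    qed
    show "finite (\<Pi>\<^sub>E i\<in>A. \<Union>m\<le>k. {c \<in> S. w i c = m})"
      by (intro finite_PiE insert.hyps finite_UN_I) (use insert.prems in auto)
  qed
  have "fps_nth (\<Prod>i\<in>insert a A. Abs_fps (\<lambda>n. \<Sum>c\<in>{c \<in> S. w i c = n}. h i c)) n =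
      (\<Sum>k=0..n. (\<Sum>c\<in>?C k. h a c) * (\<Sum>\<phi>\<in>?\<Phi> (n - k). \<Prod>i\<in>A. h i (\<phi> i)))"
    using insert by (simp add: fps_mult_nth)
  also have "\<dots> = (\<Sum>k=0..n. \<Sum>(c, \<phi>)\<in>?C k \<times> ?\<Phi> (n - k). h a c * (\<Prod>i\<in>A. h i (\<phi> i)))"
    by (simp add: sum_product sum.cartesian_product)
  also have "\<dots> = (\<Sum>(k, c, \<phi>)\<in>Sigma {0..n} (\<lambda>k. ?C k \<times> ?\<Phi> (n - k)). h a c * (\<Prod>i\<in>A. h i (\<phi> i)))"
    by (rule sum.Sigma) (use fin\<Phi> insert.prems in auto)
  also have "\<dots> = (\<Sum>\<phi>\<in>{\<phi> \<in> insert a A \<rightarrow>\<^sub>E S. (\<Sum>i\<in>insert a A. w i (\<phi> i)) = n}. \<Prod>i\<in>insert a A. h i (\<phi> i))"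
  proof (rule sum.reindex_bij_witness[of _ "\<lambda>\<phi>. (w a (\<phi> a), \<phi> a, \<phi>(a := undefined))" "\<lambda>(k, c, \<phi>). \<phi>(a := c)"])
    note a = insert.hyps(2)
    have upd: "(\<Sum>i\<in>A. w i ((\<phi>(a := c)) i)) = (\<Sum>i\<in>A. w i (\<phi> i))"
      "(\<Prod>i\<in>A. h i ((\<phi>(a := c)) i)) = (\<Prod>i\<in>A. h i (\<phi> i))" for \<phi> c
      using a by (auto intro!: sum.cong prod.cong)
    fix p assume "p \<in> Sigma {0..n} (\<lambda>k. ?C k \<times> ?\<Phi> (n - k))"
    then obtain k c \<phi> where p: "p = (k, c, \<phi>)" "k \<le> n" "c \<in> S" "w a c = k" "\<phi> \<in> A \<rightarrow>\<^sub>E S"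
      "(\<Sum>i\<in>A. w i (\<phi> i)) = n - k" by auto
    have "\<phi> a = undefined" using p(5) a by (auto simp: PiE_iff extensional_def)
    then show "(\<lambda>\<phi>. (w a (\<phi> a), \<phi> a, \<phi>(a := undefined))) ((\<lambda>(k, c, \<phi>). \<phi>(a := c)) p) = p"
      using p by (auto simp: fun_upd_idem)
    show "(\<lambda>(k, c, \<phi>). \<phi>(a := c)) p \<in> {\<phi> \<in> insert a A \<rightarrow>\<^sub>E S. (\<Sum>i\<in>insert a A. w i (\<phi> i)) = n}"
      using p a insert.hyps(1) upd(1)[of \<phi> c] by (auto simp: PiE_iff extensional_def)
    show "(\<Prod>i\<in>insert a A. h i ((case p of (k, c, \<phi>) \<Rightarrow> \<phi>(a := c)) i)) =
        (case p of (k, c, \<phi>) \<Rightarrow> h a c * (\<Prod>i\<in>A. h i (\<phi> i)))"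
      using p a insert.hyps(1) upd(2)[of \<phi> c] by simp
  next
    fix \<phi> assume \<phi>: "\<phi> \<in> {\<phi> \<in> insert a A \<rightarrow>\<^sub>E S. (\<Sum>i\<in>insert a A. w i (\<phi> i)) = n}"
    have upd: "(\<Sum>i\<in>A. w i ((\<phi>(a := undefined)) i)) = (\<Sum>i\<in>A. w i (\<phi> i))"
      using insert.hyps(2) by (auto intro!: sum.cong)
    show "(\<lambda>(k, c, \<phi>). \<phi>(a := c)) (w a (\<phi> a), \<phi> a, \<phi>(a := undefined)) = \<phi>" by simp
    show "(w a (\<phi> a), \<phi> a, \<phi>(a := undefined)) \<in> Sigma {0..n} (\<lambda>k. ?C k \<times> ?\<Phi> (n - k))"
      using \<phi> insert.hyps upd by (auto simp: PiE_iff extensional_def)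
  qed
  finally show ?case .
qed

context
  fixes V :: "('f::{field,finite}, 'p) chart set"
    and C :: "'c coloring_data" and N :: nat
  assumes V: "variety V" and C: "is_coloring_data N C"
begin

lemma zero_color: "zero_color C \<in> colors C" "cdeg C (zero_color C) = 0"
  using theI'[of "\<lambda>c. c \<in> colors C \<and> cdeg C c = 0"] C
  by (auto simp: is_coloring_data_def zero_color_def)

lemma cdeg_eq_0_iff: "c \<in> colors C \<Longrightarrow> cdeg C c = 0 \<longleftrightarrow> c = zero_color C"
  using C zero_color unfolding is_coloring_data_def by metis

lemma weight_zero_color: "weight C (zero_color C) = 1"
  using C zero_color by (auto simp: is_coloring_data_def)

lemma frob_coloring_orbit_const:
  assumes "\<Lambda> \<in> frob_colorings V C" "x \<in> points V" "y \<in> orbit (frob V) x"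
  shows "y \<in> points V \<and> \<Lambda> y = \<Lambda> x"
  using assms(3)
  by (induction rule: orbit.induct)
    (use assms(1,2) in \<open>auto simp: frob_colorings_def frob_in_points[OF V]\<close>)

lemma frob_coloring_value:
  assumes "\<Lambda> \<in> frob_colorings V C" "orb \<in> closed_points V M" "x \<in> orb"
  shows "the_elem (\<Lambda> ` orb) = \<Lambda> x"
proof -
  have c: "cyclic_on (frob V) orb" and x: "x \<in> points V" using assms by (auto simp: closed_points_def)
  have "orb = orbit (frob V) x" using orbit_cyclic_eq3[OF c assms(3)] by simp
  then have "\<Lambda> ` orb = {\<Lambda> x}" using frob_coloring_orbit_const[OF assms(1) x] assms(3) by blast
  then show ?thesis by simp
qed

lemma frob_coloring_color: "\<Lambda> \<in> frob_colorings V C \<Longrightarrow> x \<in> points V \<Longrightarrow> \<Lambda> x \<in> colors C"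
  by (auto simp: frob_colorings_def colorings_def)

text \<open>
  The support is finite and stable under the injective Frobenius map, so it consists of periodic points.
\<close>

lemma support_self_in_orbit:
  assumes \<Lambda>: "\<Lambda> \<in> frob_colorings V C" and x: "x \<in> color_support V C \<Lambda>"
  shows "x \<in> orbit (frob V) x" "orbit (frob V) x \<subseteq> color_support V C \<Lambda>"
proof -
  let ?S = "color_support V C \<Lambda>"
  show "x \<in> orbit (frob V) x"
  proof (rule self_in_orbit_of_finite[OF _ _ _ x])
    show "finite ?S" using \<Lambda> by (auto simp: frob_colorings_def colorings_def)
    show "frob V ` ?S \<subseteq> ?S"
      using \<Lambda> frob_in_points[OF V] by (auto simp: color_support_def frob_colorings_def)
    show "inj_on (frob V) ?S"
      by (rule inj_on_subset[OF inj_on_frob[OF V]]) (auto simp: color_support_def)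
  qed
  show "orbit (frob V) x \<subseteq> ?S"
    using frob_coloring_orbit_const[OF \<Lambda>, of x] x by (auto simp: color_support_def)
qed

text \<open>Both the degree and the weight of a coloring over the finite field are computed orbit by orbit.\<close>

lemma
  assumes \<Lambda>: "\<Lambda> \<in> frob_colorings V C"
    and S: "orbit (frob V) ` color_support V C \<Lambda> \<subseteq> closed_points V M"
  shows coloring_degree_closed_points: "coloring_degree V C \<Lambda> =
      (\<Sum>orb\<in>closed_points V M. card orb * cdeg C (the_elem (\<Lambda> ` orb)))"
    and coloring_weight_closed_points: "coloring_weight V C \<Lambda> =
      (\<Prod>orb\<in>closed_points V M. ml_subst_power (card orb) (weight C (the_elem (\<Lambda> ` orb))))"
proof -
  let ?S = "color_support V C \<Lambda>" and ?o = "orbit (frob V)"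
  have finS: "finite ?S" using \<Lambda> by (auto simp: frob_colorings_def colorings_def)
  have zero: "the_elem (\<Lambda> ` orb) = zero_color C" if orb: "orb \<in> closed_points V M - ?o ` ?S" for orb
  proof -
    have c: "cyclic_on (frob V) orb" using orb by (simp add: closed_points_def)
    then obtain x where x: "x \<in> orb" by (auto simp: cyclic_on_def)
    have "x \<notin> ?S" using orbit_cyclic_eq3[OF c x] orb by blast
    moreover have "x \<in> points V" using x orb by (auto simp: closed_points_def)
    ultimately show ?thesis
      using frob_coloring_value[OF \<Lambda> _ x] orb by (auto simp: color_support_def)
  qed
  have "coloring_degree V C \<Lambda> = (\<Sum>orb\<in>?o ` ?S. \<Sum>x\<in>{x \<in> ?S. ?o x = orb}. cdeg C (\<Lambda> x))"
    unfolding coloring_degree_def by (rule sum.image_gen[OF finS])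
  also have "\<dots> = (\<Sum>orb\<in>?o ` ?S. card orb * cdeg C (the_elem (\<Lambda> ` orb)))"
  proof (rule sum.cong[OF refl])
    fix orb assume orb: "orb \<in> ?o ` ?S"
    with S have cp: "orb \<in> closed_points V M" by blast
    then have c: "cyclic_on (frob V) orb" by (simp add: closed_points_def)
    have "{x \<in> ?S. ?o x = orb} = orb"
      using orb support_self_in_orbit[OF \<Lambda>] orbit_cyclic_eq3[OF c] by blast
    moreover have "(\<Sum>x\<in>orb. cdeg C (\<Lambda> x)) = (\<Sum>x\<in>orb. cdeg C (the_elem (\<Lambda> ` orb)))"
      by (rule sum.cong) (auto simp: frob_coloring_value[OF \<Lambda> cp])
    ultimately show "(\<Sum>x\<in>{x \<in> ?S. ?o x = orb}. cdeg C (\<Lambda> x)) = card orb * cdeg C (the_elem (\<Lambda> ` orb))"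
      by simp
  qed
  also have "\<dots> = (\<Sum>orb\<in>closed_points V M. card orb * cdeg C (the_elem (\<Lambda> ` orb)))"
    by (rule sum.mono_neutral_left[OF finite_closed_points[OF V] S]) (auto simp: zero zero_color)
  finally show "coloring_degree V C \<Lambda> =
      (\<Sum>orb\<in>closed_points V M. card orb * cdeg C (the_elem (\<Lambda> ` orb)))" .
  show "coloring_weight V C \<Lambda> =
      (\<Prod>orb\<in>closed_points V M. ml_subst_power (card orb) (weight C (the_elem (\<Lambda> ` orb))))"
    unfolding coloring_weight_def
  proof (rule prod.mono_neutral_left[OF finite_closed_points[OF V] S], intro ballI)
    fix orb assume orb: "orb \<in> closed_points V M - ?o ` ?S"
    then interpret cring_hom "ml_subst_power (card orb) :: int mlaurent \<Rightarrow> _"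
      by (intro cring_hom_ml_subst_power) (auto dest: closed_points_card_ge_1)
    show "ml_subst_power (card orb) (weight C (the_elem (\<Lambda> ` orb))) = 1"
      by (simp add: zero[OF orb] weight_zero_color)
  qed
qed

text \<open>A color other than 0 has degree at least 1, so the degree bounds the size of the support.\<close>

lemma support_orbits_closed_points:
  assumes \<Lambda>: "\<Lambda> \<in> frob_colorings V C" and deg: "coloring_degree V C \<Lambda> \<le> M"
  shows "orbit (frob V) ` color_support V C \<Lambda> \<subseteq> closed_points V M"
proof
  let ?S = "color_support V C \<Lambda>"
  fix orb assume "orb \<in> orbit (frob V) ` ?S"
  then obtain x where x: "x \<in> ?S" "orb = orbit (frob V) x" by blast
  note self = support_self_in_orbit[OF \<Lambda> x(1)]
  have finS: "finite ?S" using \<Lambda> by (auto simp: frob_colorings_def colorings_def)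
  have "card orb \<le> card ?S" unfolding x(2) by (rule card_mono[OF finS self(2)])
  also have "\<dots> = (\<Sum>y\<in>?S. 1)" by simp
  also have "\<dots> \<le> coloring_degree V C \<Lambda>"
    unfolding coloring_degree_def
  proof (rule sum_mono)
    fix y assume y: "y \<in> ?S"
    then have "\<Lambda> y \<in> colors C" "\<Lambda> y \<noteq> zero_color C"
      using frob_coloring_color[OF \<Lambda>] by (auto simp: color_support_def)
    then show "1 \<le> cdeg C (\<Lambda> y)" using cdeg_eq_0_iff by (metis less_one not_le)
  qed
  finally have "card orb \<le> M" using deg by simp
  moreover have "cyclic_on (frob V) orb" unfolding x(2) using self(1) by (auto simp: cyclic_on_def)
  moreover have "orb \<subseteq> points V" using self(2) by (auto simp: x(2) color_support_def)
  ultimately show "orb \<in> closed_points V M" by (simp add: closed_points_def)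
qed

text \<open>
  The coloring with value \<open>\<phi> orb\<close> on each closed point \<open>orb\<close> of degree at most \<open>M\<close> and color 0
  at all other points.
\<close>

definition coloring_of :: "nat \<Rightarrow> ('p set \<Rightarrow> 'c) \<Rightarrow> 'p \<Rightarrow> 'c" where
  "coloring_of M \<phi> = (\<lambda>x\<in>points V.
     if orbit (frob V) x \<in> closed_points V M then \<phi> (orbit (frob V) x) else zero_color C)"

lemma orbit_closed_point:
  assumes "orb \<in> closed_points V M" "x \<in> orb"
  shows "orbit (frob V) x = orb"
  by (rule orbit_cyclic_eq3) (use assms in \<open>simp_all add: closed_points_def\<close>)

lemma self_in_closed_point:
  assumes "x \<in> points V" "orbit (frob V) x \<in> closed_points V M"
  shows "x \<in> orbit (frob V) x"
proof (rule self_in_orbit_of_step[OF inj_on_frob[OF V] _ assms(1)])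
  have "orbit (frob V) (frob V x) = orbit (frob V) x"
    by (rule orbit_closed_point[OF assms(2) orbit.base])
  then show "frob V x \<in> orbit (frob V) (frob V x)" using orbit.base by metis
  show "frob V ` points V \<subseteq> points V" using frob_in_points[OF V] by blast
qed

lemma
  assumes \<phi>: "\<phi> \<in> closed_points V M \<rightarrow>\<^sub>E colors C"
  shows coloring_of_in: "coloring_of M \<phi> \<in> frob_colorings V C"
    and coloring_of_support: "orbit (frob V) ` color_support V C (coloring_of M \<phi>) \<subseteq> closed_points V M"
    and coloring_of_value: "orb \<in> closed_points V M \<Longrightarrow> the_elem (coloring_of M \<phi> ` orb) = \<phi> orb"
proof -
  let ?\<Lambda> = "coloring_of M \<phi>"
  show supp: "orbit (frob V) ` color_support V C ?\<Lambda> \<subseteq> closed_points V M"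
    by (auto simp: color_support_def coloring_of_def split: if_splits)
  have "color_support V C ?\<Lambda> \<subseteq> \<Union>(closed_points V M)"
  proof
    fix x assume x: "x \<in> color_support V C ?\<Lambda>"
    then have "orbit (frob V) x \<in> closed_points V M" using supp by blast
    moreover have "x \<in> orbit (frob V) x"
      using x self_in_closed_point calculation by (auto simp: color_support_def)
    ultimately show "x \<in> \<Union>(closed_points V M)" by blast
  qed
  moreover have "finite (\<Union>(closed_points V M))"
    using finite_closed_points[OF V] by (auto simp: closed_points_def intro: finite_cyclic_on)
  ultimately have fin: "finite (color_support V C ?\<Lambda>)" by (rule finite_subset)
  have inv: "?\<Lambda> (frob V x) = ?\<Lambda> x" if x: "x \<in> points V" for x
  proof -
    have "orbit (frob V) (frob V x) = orbit (frob V) x \<or>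
      orbit (frob V) (frob V x) \<notin> closed_points V M \<and> orbit (frob V) x \<notin> closed_points V M"
    proof (cases "orbit (frob V) x \<in> closed_points V M")
      case True
      then show ?thesis using orbit_closed_point[OF True orbit.base] by blast
    next
      case False
      have "orbit (frob V) (frob V x) \<notin> closed_points V M"
      proof
        assume cp: "orbit (frob V) (frob V x) \<in> closed_points V M"
        have "frob V x \<in> orbit (frob V) (frob V x)"
          by (rule self_in_closed_point[OF frob_in_points[OF V x] cp])
        then have "x \<in> orbit (frob V) x"
          by (rule self_in_orbit_of_step[OF inj_on_frob[OF V] _ x, rotated]) (use frob_in_points[OF V] in blast)
        then have "orbit (frob V) (frob V x) = orbit (frob V) x" by (rule self_in_orbit_step)
        then show False using cp False by simp
      qed
      with False show ?thesis by blast
    qed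
    then show ?thesis using x frob_in_points[OF V x] by (auto simp: coloring_of_def)
  qed
  have "?\<Lambda> \<in> points V \<rightarrow>\<^sub>E colors C"
    using \<phi> zero_color(1) by (auto simp: coloring_of_def)
  with fin inv show mem: "?\<Lambda> \<in> frob_colorings V C" by (auto simp: frob_colorings_def colorings_def)
  assume orb: "orb \<in> closed_points V M"
  then obtain x where x: "x \<in> orb" "x \<in> points V" by (auto simp: closed_points_def cyclic_on_def)
  then show "the_elem (?\<Lambda> ` orb) = \<phi> orb"
    unfolding frob_coloring_value[OF mem orb x(1)]
    using orb by (simp add: coloring_of_def orbit_closed_point[OF orb x(1)])
qed

lemma coloring_of_inverse:
  assumes \<Lambda>: "\<Lambda> \<in> frob_colorings V C"
    and S: "orbit (frob V) ` color_support V C \<Lambda> \<subseteq> closed_points V M"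
  shows "coloring_of M (\<lambda>orb\<in>closed_points V M. the_elem (\<Lambda> ` orb)) = \<Lambda>"
proof
  fix x
  show "coloring_of M (\<lambda>orb\<in>closed_points V M. the_elem (\<Lambda> ` orb)) x = \<Lambda> x"
  proof (cases "x \<in> points V")
    case False
    then show ?thesis using \<Lambda> by (auto simp: coloring_of_def frob_colorings_def colorings_def PiE_iff extensional_def)
  next
    case x: True
    show ?thesis
    proof (cases "orbit (frob V) x \<in> closed_points V M")
      case True
      then show ?thesis
        using x frob_coloring_value[OF \<Lambda> True self_in_closed_point[OF x True]] by (simp add: coloring_of_def)
    next
      case False
      then have "x \<notin> color_support V C \<Lambda>" using S by blast
      with x False show ?thesis by (auto simp: coloring_of_def color_support_def)
    qed
  qed
qed

text \<open>
  Up to \<open>T\<^sup>M\<close>, the coloring zeta function is the product over the closed points of degree \<open>d \<le> M\<close> of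
  \<open>Z\<^sub>C(\<bullet>, t\<^sup>d, T\<^sup>d)\<close>: a coloring is a free choice of a color for each closed point.
\<close>

lemma coloring_zeta_nth:
  assumes n: "n \<le> M"
  shows "fps_nth (coloring_zeta V C) n =
     fps_nth (\<Prod>orb\<in>closed_points V M. adams (card orb) (coloring_zeta_point C)) n"
proof -
  let ?O = "closed_points V M"
  have adams: "adams (card orb) (coloring_zeta_point C) =
      Abs_fps (\<lambda>n. \<Sum>c\<in>{c \<in> colors C. card orb * cdeg C c = n}. ml_subst_power (card orb) (weight C c))"
    if "orb \<in> ?O" for orb
  proof (rule fps_ext)
    fix n
    have d: "card orb \<ge> 1" using that by (rule closed_points_card_ge_1)
    interpret cring_hom "ml_subst_power (card orb) :: int mlaurent \<Rightarrow> _"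
      by (rule cring_hom_ml_subst_power[OF d])
    have "{c \<in> colors C. card orb * cdeg C c = n} =
        (if card orb dvd n then {c \<in> colors C. cdeg C c = n div card orb} else {})"
      using d by auto
    then show "fps_nth (adams (card orb) (coloring_zeta_point C)) n =
      fps_nth (Abs_fps (\<lambda>n. \<Sum>c\<in>{c \<in> colors C. card orb * cdeg C c = n}. ml_subst_power (card orb) (weight C c))) n"
      by (simp add: adams_nth coloring_zeta_point_def hom_sum)
  qed
  have "fps_nth (coloring_zeta V C) n =
      (\<Sum>\<Lambda>\<in>{\<Lambda> \<in> frob_colorings V C. coloring_degree V C \<Lambda> = n}. coloring_weight V C \<Lambda>)"
    by (simp add: coloring_zeta_def)
  also have "\<dots> = (\<Sum>\<phi>\<in>{\<phi> \<in> ?O \<rightarrow>\<^sub>E colors C. (\<Sum>orb\<in>?O. card orb * cdeg C (\<phi> orb)) = n}.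
      \<Prod>orb\<in>?O. ml_subst_power (card orb) (weight C (\<phi> orb)))"
  proof (rule sum.reindex_bij_witness[of _ "coloring_of M" "\<lambda>\<Lambda>. \<lambda>orb\<in>?O. the_elem (\<Lambda> ` orb)"])
    fix \<Lambda> assume "\<Lambda> \<in> {\<Lambda> \<in> frob_colorings V C. coloring_degree V C \<Lambda> = n}"
    then have \<Lambda>: "\<Lambda> \<in> frob_colorings V C" "coloring_degree V C \<Lambda> = n" by auto
    have S: "orbit (frob V) ` color_support V C \<Lambda> \<subseteq> ?O"
      using \<Lambda> n by (intro support_orbits_closed_points) auto
    show "coloring_of M (\<lambda>orb\<in>?O. the_elem (\<Lambda> ` orb)) = \<Lambda>" by (rule coloring_of_inverse[OF \<Lambda>(1) S])
    have "the_elem (\<Lambda> ` orb) \<in> colors C" if orb: "orb \<in> ?O" for orb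
    proof -
      obtain x where x: "x \<in> orb" "x \<in> points V" using orb by (auto simp: closed_points_def cyclic_on_def)
      then show ?thesis using frob_coloring_value[OF \<Lambda>(1) orb x(1)] frob_coloring_color[OF \<Lambda>(1) x(2)] by simp
    qed
    then show "(\<lambda>orb\<in>?O. the_elem (\<Lambda> ` orb)) \<in>
        {\<phi> \<in> ?O \<rightarrow>\<^sub>E colors C. (\<Sum>orb\<in>?O. card orb * cdeg C (\<phi> orb)) = n}"
      using coloring_degree_closed_points[OF \<Lambda>(1) S] \<Lambda>(2) by simp
    show "(\<Prod>orb\<in>?O. ml_subst_power (card orb) (weight C ((\<lambda>orb\<in>?O. the_elem (\<Lambda> ` orb)) orb))) =
        coloring_weight V C \<Lambda>"
      unfolding coloring_weight_closed_points[OF \<Lambda>(1) S] by (rule prod.cong) auto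
  next
    fix \<phi> assume "\<phi> \<in> {\<phi> \<in> ?O \<rightarrow>\<^sub>E colors C. (\<Sum>orb\<in>?O. card orb * cdeg C (\<phi> orb)) = n}"
    then have \<phi>: "\<phi> \<in> ?O \<rightarrow>\<^sub>E colors C" "(\<Sum>orb\<in>?O. card orb * cdeg C (\<phi> orb)) = n" by auto
    note co = coloring_of_in[OF \<phi>(1)] coloring_of_support[OF \<phi>(1)] coloring_of_value[OF \<phi>(1)]
    show "(\<lambda>orb\<in>?O. the_elem (coloring_of M \<phi> ` orb)) = \<phi>"
      using \<phi>(1) co(3) by (auto simp: PiE_iff extensional_def)
    show "coloring_of M \<phi> \<in> {\<Lambda> \<in> frob_colorings V C. coloring_degree V C \<Lambda> = n}"
      using coloring_degree_closed_points[OF co(1,2)] co(1,3) \<phi>(2) by simp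
  qed
  also have "\<dots> = fps_nth (\<Prod>orb\<in>?O. Abs_fps (\<lambda>n. \<Sum>c\<in>{c \<in> colors C. card orb * cdeg C c = n}.
      ml_subst_power (card orb) (weight C c))) n"
  proof (rule fps_nth_prod_PiE[symmetric, OF finite_closed_points[OF V]])
    fix orb n assume "orb \<in> ?O"
    then have "{c \<in> colors C. card orb * cdeg C c = n} \<subseteq> (\<Union>k\<le>n. {c \<in> colors C. cdeg C c = k})"
      using closed_points_card_ge_1[of orb V M] by auto
    then show "finite {c \<in> colors C. card orb * cdeg C c = n}"
      by (rule finite_subset) (use C in \<open>auto simp: is_coloring_data_def\<close>)
  qed
  also have "\<dots> = fps_nth (\<Prod>orb\<in>?O. adams (card orb) (coloring_zeta_point C)) n"
    by (simp add: adams cong: prod.cong)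
  finally show ?thesis .
qed

text \<open>
  A closed point of degree \<open>d\<close> contributes \<open>d e A\<^sub>e(t\<^sup>k\<^sup>/\<^sup>e)\<close> to the coefficient of \<open>T\<^sup>k\<close> of the logarithmic
  derivative whenever \<open>d e\<close> divides \<open>k\<close>. Summing over the closed points first turns the degrees into
  the number of points over the extension of degree \<open>k / e\<close>.
\<close>

lemma has_dlog_coloring_zeta:
  assumes A: "has_dlog (coloring_zeta_point C) (fps_hom (\<lambda>p. poly p 1) (product_dlog A))"
  shows "has_dlog (coloring_zeta V C) (Abs_fps (\<lambda>n. \<Sum>e\<in>{e. e dvd n \<and> 0 < n}.
     of_nat (e * card (rational_points V (n div e))) * ml_subst_power (n div e) (A e)))"
    (is "has_dlog _ (Abs_fps ?L)")
proof -
  let ?O = "closed_points V" and ?L1 = "fps_hom (\<lambda>p. poly p 1) (product_dlog A)"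
  let ?P = "\<lambda>M. \<Prod>orb\<in>?O M. adams (card orb) (coloring_zeta_point C)"
  let ?LM = "\<lambda>M. \<Sum>orb\<in>?O M. of_nat (card orb) * adams (card orb) ?L1"
  have dlog: "has_dlog (?P M) (?LM M)" for M
    by (intro has_dlog_prod has_dlog_adams A closed_points_card_ge_1)
  have L1: "fps_nth ?L1 n = (\<Sum>e\<in>{e. e dvd n \<and> 0 < n}. of_nat e * ml_subst_power (n div e) (A e))" for n
    by (simp add: product_dlog_def poly_sum poly_monom)
  have LM: "fps_nth (?LM M) k = ?L k" if k: "k \<le> M" for M k
  proof (cases "k = 0")
    case True
    then show ?thesis using dlog[of M] by (auto simp: has_dlog_iff dest: spec[of _ 0])
  next
    case False
    let ?E = "\<lambda>n. {e. e dvd n \<and> 0 < n}"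
    let ?t = "\<lambda>e. of_nat e * ml_subst_power (k div e) (A e)"
    have orb: "fps_nth (of_nat (card orb) * adams (card orb) ?L1) k =
        (\<Sum>e\<in>?E k. if card orb dvd k div e then of_nat (card orb) * ?t e else 0)" if "orb \<in> ?O M" for orb
    proof -
      define d where "d = card orb"
      have d: "d \<ge> 1" unfolding d_def by (rule closed_points_card_ge_1[OF that])
      interpret cring_hom "ml_subst_power d :: int mlaurent \<Rightarrow> _" by (rule cring_hom_ml_subst_power[OF d])
      have "fps_nth (of_nat d * adams d ?L1) k = of_nat d * fps_nth (adams d ?L1) k"
        by (metis fps_mult_left_const_nth fps_of_nat)
      also have "\<dots> = (\<Sum>e\<in>?E k. if d dvd k div e then of_nat d * ?t e else 0)"
      proof (cases "d dvd k")
        case True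
        then obtain r where r: "k = d * r" by blast
        have "r > 0" using False r by simp
        have "of_nat d * fps_nth (adams d ?L1) k =
            of_nat d * (\<Sum>e\<in>?E r. of_nat e * ml_subst_power d (ml_subst_power (r div e) (A e)))"
          using d unfolding adams_nth L1 by (simp add: r hom_sum hom_mult hom_of_nat)
        also have "\<dots> = (\<Sum>e\<in>?E r. of_nat d * ?t e)"
          unfolding sum_distrib_left
        proof (rule sum.cong[OF refl])
          fix e assume e: "e \<in> ?E r"
          then have "r div e \<ge> 1" by (auto elim!: dvdE)
          moreover have "d * (r div e) = k div e" using e r by (simp add: div_mult_swap)
          ultimately show "of_nat d * (of_nat e * ml_subst_power d (ml_subst_power (r div e) (A e))) = of_nat d * ?t e"
            using subst_subst[OF d, of "r div e" "A e"] by simp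
        qed
        also have "\<dots> = (\<Sum>e\<in>?E k. if d dvd k div e then of_nat d * ?t e else 0)"
        proof (rule sum.mono_neutral_cong_left[OF finite_divisors])
          have *: "e dvd r \<longleftrightarrow> e dvd k \<and> d dvd k div e" for e
          proof
            assume "e dvd r"
            then obtain s where s: "r = e * s" by blast
            then have "k = e * (d * s)" "e > 0" using r \<open>r > 0\<close> by auto
            then show "e dvd k \<and> d dvd k div e" by auto
          next
            assume "e dvd k \<and> d dvd k div e"
            then obtain s where "k div e = d * s" and "e * (k div e) = k" by (metis dvdE dvd_mult_div_cancel)
            then have "d * (e * s) = d * r" using r by (simp add: mult.left_commute)
            then show "e dvd r" using d by auto
          qed
          show "?E r \<subseteq> ?E k" using * False by auto
          show "\<forall>e\<in>?E k - ?E r. (if d dvd k div e then of_nat d * ?t e else 0) = 0"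
            using * \<open>r > 0\<close> by auto
          show "of_nat d * ?t e = (if d dvd k div e then of_nat d * ?t e else 0)" if "e \<in> ?E r" for e
            using that * by auto
        qed
        finally show ?thesis .
      next
        case nd: False
        have "\<not> d dvd k div e" if "e dvd k" for e
          using nd that by (metis dvd_mult_div_cancel dvd_mult)
        then have "(\<Sum>e\<in>?E k. if d dvd k div e then of_nat d * ?t e else 0) = 0"
          by (intro sum.neutral) auto
        then show ?thesis using nd by (simp add: adams_nth)
      qed
      finally show ?thesis unfolding d_def .
    qed
    have "fps_nth (?LM M) k =
        (\<Sum>orb\<in>?O M. \<Sum>e\<in>?E k. if card orb dvd k div e then of_nat (card orb) * ?t e else 0)"
      unfolding fps_sum_nth by (rule sum.cong[OF refl orb])
    also have "\<dots> = (\<Sum>e\<in>?E k. \<Sum>orb\<in>?O M. if card orb dvd k div e then of_nat (card orb) * ?t e else 0)"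
      by (rule sum.swap)
    also have "\<dots> = ?L k"
    proof (rule sum.cong[OF refl])
      fix e assume "e \<in> ?E k"
      then have "1 \<le> k div e" "k div e \<le> M" using k
        by (auto elim!: dvdE intro: order_trans[OF div_le_dividend])
      note N = card_rational_points[OF V this]
      have "(\<Sum>orb\<in>?O M. if card orb dvd k div e then of_nat (card orb) * ?t e else 0) =
          of_nat (\<Sum>orb\<in>?O M. if card orb dvd k div e then card orb else 0) * ?t e"
        unfolding of_nat_sum sum_distrib_right by (rule sum.cong) auto
      then show "(\<Sum>orb\<in>?O M. if card orb dvd k div e then of_nat (card orb) * ?t e else 0) =
          of_nat (e * card (rational_points V (k div e))) * ml_subst_power (k div e) (A e)"
        unfolding N by (simp add: mult_ac)
    qed
    finally show ?thesis .
  qed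
  show ?thesis
    unfolding has_dlog_iff
  proof (intro conjI allI)
    show "fps_nth (coloring_zeta V C) 0 = 1"
      using coloring_zeta_nth[of 0 0] dlog[of 0] by (simp add: has_dlog_def)
    fix n
    have "of_nat n * fps_nth (?P n) n = (\<Sum>j=0..n. fps_nth (?P n) j * fps_nth (?LM n) (n - j))"
      using dlog[of n] unfolding has_dlog_iff by blast
    also have "\<dots> = (\<Sum>j=0..n. fps_nth (coloring_zeta V C) j * fps_nth (Abs_fps ?L) (n - j))"
      by (rule sum.cong) (simp_all add: coloring_zeta_nth[of _ n] LM[of _ n] del: fps_sum_nth)
    finally show "of_nat n * fps_nth (coloring_zeta V C) n =
        (\<Sum>j=0..n. fps_nth (coloring_zeta V C) j * fps_nth (Abs_fps ?L) (n - j))"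
      by (simp only: coloring_zeta_nth[of n n, OF order_refl])
  qed
qed

end

section \<open>Point counts and specialization\<close>

lemma has_dlog_dlog_unique:
  assumes "has_dlog P L" "has_dlog P L'"
  shows "L = L'"
proof -
  have "P * L = P * L'" using assms by (simp add: has_dlog_def)
  then have "(THE b. P * b = 1) * (P * L) = (THE b. P * b = 1) * (P * L')" by simp
  moreover have "(THE b. P * b = 1) * P = 1"
    using unit_inverse_exists[of P] assms(1) by (simp add: has_dlog_def mult.commute)
  ultimately show ?thesis by (simp flip: mult.assoc)
qed

lemma has_dlog_zeta:
  "has_dlog (zeta V) (Abs_fps (\<lambda>r. if r = 0 then 0 else of_nat (card (rational_points V r))))"
proof -
  let ?a = "Abs_fps (\<lambda>r. if r = 0 then 0 else of_nat (card (rational_points V r)) / of_nat r) :: complex fps"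
  have "fps_deriv (zeta V) = zeta V * fps_deriv ?a"
    unfolding zeta_def by (subst fps_compose_deriv) simp_all
  then have "fps_X * fps_deriv (zeta V) = zeta V * (fps_X * fps_deriv ?a)" by (simp only: mult.left_commute)
  moreover have "fps_X * fps_deriv ?a = Abs_fps (\<lambda>r. if r = 0 then 0 else of_nat (card (rational_points V r)))"
    by (rule fps_ext) (simp add: fps_X_deriv_nth del: fps_X_mult_nth)
  moreover have "fps_nth (zeta V) 0 = 1" by (simp add: zeta_def fps_compose_nth_0)
  ultimately show ?thesis by (simp add: has_dlog_def)
qed

lemma powi_eq_unit_powi:
  fixes P :: "'a::field fps"
  assumes "fps_nth P 0 = 1"
  shows "P powi k = unit_powi P k"
proof -
  have "P * inverse P = 1" by (rule inverse_mult_eq_1') (simp add: assms)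
  then have "(THE b. P * b = 1) = inverse P" by (rule the_inverse_eqI)
  then show ?thesis by (simp add: power_int_def unit_powi_def)
qed

text \<open>Comparison of the coefficients of \<open>T Z'(T) / Z(T)\<close> on both sides.\<close>

lemma card_rational_points_eq:
  assumes "zeta V = (\<Prod>i\<in>I. (1 - fps_const (x i) * fps_X) powi (- n i))" "r \<ge> 1"
  shows "of_nat (card (rational_points V r)) = (\<Sum>i\<in>I. of_int (n i) * x i ^ r)"
proof -
  let ?G = "\<lambda>i. Abs_fps (\<lambda>k. if k > 0 \<and> 1 dvd k then of_nat 1 * x i ^ (k div 1) else 0)"
  have "has_dlog ((1 - fps_const (x i) * fps_X) powi (- n i)) (of_int (- n i) * (- ?G i))" for i
    using has_dlog_unit_powi[OF has_dlog_one_minus[of 1 "x i"], of "- n i"]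
    by (simp add: powi_eq_unit_powi)
  then have "has_dlog (zeta V) (\<Sum>i\<in>I. of_int (- n i) * (- ?G i))"
    unfolding assms(1) by (intro has_dlog_prod)
  from arg_cong[OF has_dlog_dlog_unique[OF has_dlog_zeta this], of "\<lambda>F. fps_nth F r"]
  have "of_nat (card (rational_points V r)) = fps_nth (\<Sum>i\<in>I. of_int (- n i) * (- ?G i)) r"
    using assms(2) by (simp only: fps_nth_Abs_fps split: if_splits)
  also have "\<dots> = (\<Sum>i\<in>I. of_int (n i) * x i ^ r)"
    unfolding fps_sum_nth using assms(2) by (intro sum.cong) (simp_all flip: fps_of_int)
  finally show ?thesis .
qed

lemma (in cring_hom) cring_hom_eval_map_poly:
  "cring_hom (\<lambda>p. poly (map_poly h p) y)"
proof -
  have add: "map_poly h (p + q) = map_poly h p + map_poly h q" for p q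
    by (rule poly_eqI) (simp add: coeff_map_poly hom_add)
  have mult: "map_poly h (p * q) = map_poly h p * map_poly h q" for p q
    by (rule poly_eqI) (simp add: coeff_map_poly coeff_mult hom_sum hom_mult)
  have one: "map_poly h 1 = 1"
    by (rule poly_eqI) (simp add: coeff_map_poly)
  show ?thesis by unfold_locales (simp_all add: add mult one)
qed

lemma fps_ml_of_int_eq: "fps_ml_of_int P = fps_hom ml_of_int P"
  by (simp add: fps_ml_of_int_def fps_hom_def)

lemma specialize_u_eq:
  "specialize_u y P = fps_hom (\<lambda>p. poly (map_poly ml_of_int p) (ml_monom y 0)) P"
  by (simp add: specialize_u_def fps_hom_def)

theorem theorem3:
  fixes V :: "('f::{field,finite}, 'p) chart set"
    and C :: "'c coloring_data"
    and N :: nat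
    and v :: "nat \<Rightarrow> (nat \<Rightarrow>\<^sub>0 int) \<Rightarrow> int"
    and I :: "'i set"
    and x :: "'i \<Rightarrow> complex"
    and n :: "'i \<Rightarrow> int"
  assumes "variety V"
    and "is_coloring_data N C"
    and "product_exponents N C v"
    and "finite I"
    and "zeta V = (\<Prod>i\<in>I. (1 - fps_const (x i) * fps_X) powi (- n i))"
  shows "fps_ml_of_int (coloring_zeta V C) =
    (\<Prod>i\<in>I. unit_powi (specialize_u (x i) (coloring_zeta_u N v)) (n i))"
proof -
  obtain A where Zu: "has_dlog (coloring_zeta_u N v) (product_dlog A)"
    and Zp: "has_dlog (coloring_zeta_point C) (fps_hom (\<lambda>p. poly p 1) (product_dlog A))"
    using coloring_zeta_u_dlog[OF assms(3)] .
  let ?N = "\<lambda>r. card (rational_points V r)"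
  let ?L = "Abs_fps (\<lambda>k. \<Sum>e\<in>{e. e dvd k \<and> 0 < k}. of_nat (e * ?N (k div e)) * ml_subst_power (k div e) (A e))"
  let ?ev = "\<lambda>i p. poly (map_poly ml_of_int p) (ml_monom (x i) 0)"
  have lhs: "has_dlog (fps_ml_of_int (coloring_zeta V C)) (fps_hom ml_of_int ?L)"
    unfolding fps_ml_of_int_eq
    by (intro ml_of_int.has_dlog_hom has_dlog_coloring_zeta[OF assms(1,2) Zp])
  have hom: "cring_hom (?ev i)" for i by (rule ml_of_int.cring_hom_eval_map_poly)
  have "has_dlog (specialize_u (x i) (coloring_zeta_u N v)) (fps_hom (?ev i) (product_dlog A))" for i
    unfolding specialize_u_eq by (rule cring_hom.has_dlog_hom[OF hom Zu])
  then have rhs: "has_dlog (\<Prod>i\<in>I. unit_powi (specialize_u (x i) (coloring_zeta_u N v)) (n i))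
      (\<Sum>i\<in>I. of_int (n i) * fps_hom (?ev i) (product_dlog A))"
    by (intro has_dlog_prod has_dlog_unit_powi)
  have "(\<Sum>i\<in>I. of_int (n i) * fps_hom (?ev i) (product_dlog A)) = fps_hom ml_of_int ?L"
  proof (rule fps_ext)
    fix k :: nat
    let ?E = "{e. e dvd k \<and> 0 < k}"
    let ?t = "\<lambda>e. of_nat e * ml_of_int (ml_subst_power (k div e) (A e))"
    have "fps_nth (of_int (n i) * fps_hom (?ev i) (product_dlog A)) k =
        (\<Sum>e\<in>?E. ?t e * (of_int (n i) * ml_monom (x i) 0 ^ (k div e)))" for i
    proof -
      interpret ev: cring_hom "?ev i" by (rule hom)
      have "fps_nth (fps_hom (?ev i) (product_dlog A)) k = (\<Sum>e\<in>?E. ?t e * ml_monom (x i) 0 ^ (k div e))"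
        by (simp add: product_dlog_def ev.hom_sum ev.hom_mult ev.hom_of_nat map_poly_monom poly_monom mult.assoc)
      moreover have "fps_nth (of_int (n i) * F) k = of_int (n i) * fps_nth F k" for F :: "complex mlaurent fps"
        by (metis fps_mult_left_const_nth fps_of_int)
      ultimately show ?thesis by (simp only: sum_distrib_left mult.left_commute)
    qed
    then have "fps_nth (\<Sum>i\<in>I. of_int (n i) * fps_hom (?ev i) (product_dlog A)) k =
        (\<Sum>i\<in>I. \<Sum>e\<in>?E. ?t e * (of_int (n i) * ml_monom (x i) 0 ^ (k div e)))"
      by (simp only: fps_sum_nth)
    also have "\<dots> = (\<Sum>e\<in>?E. ?t e * (\<Sum>i\<in>I. of_int (n i) * ml_monom (x i) 0 ^ (k div e)))"
      by (subst sum.swap) (simp only: sum_distrib_left)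
    also have "\<dots> = (\<Sum>e\<in>?E. ?t e * of_nat (?N (k div e)))"
    proof (rule sum.cong[OF refl])
      fix e assume "e \<in> ?E"
      then have r: "k div e \<ge> 1" by (auto elim!: dvdE)
      have "(\<Sum>i\<in>I. of_int (n i) * ml_monom (x i) 0 ^ (k div e)) =
          ml_monom (\<Sum>i\<in>I. of_int (n i) * x i ^ (k div e)) 0"
        by (simp only: constant_hom.hom_sum constant_hom.hom_mult constant_hom.hom_of_int constant_hom.hom_power)
      also have "\<dots> = of_nat (?N (k div e))"
        unfolding card_rational_points_eq[OF assms(5) r, symmetric] by (rule constant_hom.hom_of_nat)
      finally show "?t e * (\<Sum>i\<in>I. of_int (n i) * ml_monom (x i) 0 ^ (k div e)) = ?t e * of_nat (?N (k div e))"
        by simp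
    qed
    also have "\<dots> = fps_nth (fps_hom ml_of_int ?L) k"
      by (simp add: ml_of_int.hom_sum ml_of_int.hom_mult ml_of_int.hom_of_nat mult_ac)
    finally show "fps_nth (\<Sum>i\<in>I. of_int (n i) * fps_hom (?ev i) (product_dlog A)) k =
        fps_nth (fps_hom ml_of_int ?L) k" .
  qed
  with rhs have "has_dlog (\<Prod>i\<in>I. unit_powi (specialize_u (x i) (coloring_zeta_u N v)) (n i)) (fps_hom ml_of_int ?L)"
    by simp
  then show ?thesis by (rule has_dlog_unique[OF lhs]) (rule mlaurent_torsion_free)
qed

end
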